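(* Let $l$ be an odd positive integer, let $k\ge1$ and $m\ge0$ be integers, and let $x\in\mathbb{Z}_p$. Then $$E_{m,q}^{(0,k)}(x)=\frac{[l]_q^m}{[l]_{-q}^k}\sum_{i_1,\dots,i_k=0}^{l-1}q^{-\sum_{j=2}^k(j-1)i_j}(-1)^{\sum_{j=1}^k i_j}E_{m,q^l}^{(0,k)}\Big(\frac{x+i_1+\cdots+i_k}{l}\Big).$$ Moreover, $$E_{m,q}^{(0,k)}(lx)=\frac{[l]_q^m}{[l]_{-q}^k}\sum_{i_1,\dots,i_k=0}^{l-1}q^{-\sum_{j=2}^k(j-1)i_j}(-1)^{\sum_{j=1}^k i_j}E_{m,q^l}^{(0,k)}\Big(x+\frac{i_1+\cdots+i_k}{l}\Big).$$
   Context: Let $p$ be an odd prime, $\mathbb{C}_p$ the completion of the algebraic closure of $\mathbb{Q}_p$, with $|p|_p=p^{-1}$. For $Q\in\mathbb{C}_p$ with $|1-Q|_p<p^{-1/(p-1)}$ (this holds for $Q=q$ and $Q=q^l$ below) and $x\in\mathbb{Z}_p$ put $Q^x=\exp(x\log Q)$ and $[x]_Q=\frac{1-Q^x}{1-Q}$; $[2]_Q=1+Q$, and $[l]_{-q}=\frac{1-(-q)^l}{1+q}$. Fix $q\in\mathbb{C}_p$ with $|1-q|_p<p^{-1/(p-1)}$. For $f:\mathbb{Z}_p\to\mathbb{C}_p$ (uniformly differentiable) define $$\int_{\mathbb{Z}_p}f(x)\,d\mu_{-Q}(x)=\lim_{N\to\infty}\frac{[2]_Q}{1+Q^{p^N}}\sum_{x=0}^{p^N-1}f(x)(-1)^xQ^x;$$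 multiple integrals are iterated. For $k\ge1$, $m\ge0$ define $$E_{m,Q}^{(0,k)}(y)=\int_{\mathbb{Z}_p}\cdots\int_{\mathbb{Z}_p}[y+x_1+\cdots+x_k]_Q^m\,Q^{-\sum_{j=1}^k jx_j}\,d\mu_{-Q}(x_1)\cdots d\mu_{-Q}(x_k).$$ When $Q=q^l$ and the argument $y$ satisfies $ly\in\mathbb{Z}_p$ (as for $y=(x+i_1+\cdots+i_k)/l$), the power $(q^l)^{y+x_1+\cdots+x_k}$ is understood as $q^{ly+l(x_1+\cdots+x_k)}$. *)

theory Defs
  imports
    "HOL-Analysis.Analysis"
    "HOL-Computational_Algebra.Polynomial"
    "HOL-Computational_Algebra.Primes"
    "HOL-Library.FuncSet"
begin

text \<open>
  The field \<open>\<complex>\<^sub>p\<close> is given by a type carrying a field structure of characteristic 0 and a complete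
  metric; its absolute value is the distance from 0.  Inside it, \<open>\<rat>\<^sub>p\<close> is the closure of the
  rationals, and the algebraic closure of \<open>\<rat>\<^sub>p\<close> is the set of all elements that are algebraic over \<open>\<rat>\<^sub>p\<close>.
\<close>

definition pabs :: "'a::{field_char_0, complete_space} \<Rightarrow> real" where
  "pabs z = dist z 0"

definition padic_rats :: "'a::{field_char_0, complete_space} set" where
  "padic_rats = closure \<rat>"

definition padic_ints :: "'a::{field_char_0, complete_space} set" where
  "padic_ints = {z \<in> padic_rats. pabs z \<le> 1}"

definition padic_algebraics :: "'a::{field_char_0, complete_space} set" where
  "padic_algebraics =
     {z. \<exists>P. P \<noteq> 0 \<and> (\<forall>i. coeff P i \<in> padic_rats) \<and> poly P z = 0}"

text \<open>
  The type \<open>'a\<close> is \<open>\<complex>\<^sub>p\<close>: its metric is induced by a non-archimedean absolute value with \<open>\<bar>p\<bar> = 1 / p\<close>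
  (which determines it on the rationals, so that \<open>padic_rats\<close> is \<open>\<rat>\<^sub>p\<close>), the elements algebraic
  over \<open>\<rat>\<^sub>p\<close> form an algebraically closed field, and \<open>'a\<close>, which is complete by its sort, is the completion
  of that field.
\<close>

definition is_padic_complex :: "nat \<Rightarrow> 'a::{field_char_0, complete_space} itself \<Rightarrow> bool"
  where
  "is_padic_complex p _ \<longleftrightarrow>
     prime p \<and>
     (\<forall>x y :: 'a. dist x y = pabs (x - y)) \<and>
     (\<forall>x y :: 'a. pabs (x * y) = pabs x * pabs y) \<and>
     (\<forall>x y :: 'a. pabs (x + y) \<le> max (pabs x) (pabs y)) \<and>
     pabs (of_nat p :: 'a) = 1 / real p \<and>
     (\<forall>P :: 'a poly. degree P > 0 \<and> (\<forall>i. coeff P i \<in> padic_algebraics) \<longrightarrow>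
        (\<exists>z \<in> padic_algebraics. poly P z = 0)) \<and>
     closure (padic_algebraics :: 'a set) = UNIV"

definition padic_exp ::
  "'a::{field_char_0, complete_space} \<Rightarrow> 'a" where
  "padic_exp z = (\<Sum>n. z ^ n / fact n)"

definition padic_log ::
  "'a::{field_char_0, complete_space} \<Rightarrow> 'a" where
  "padic_log Q = (\<Sum>n. (- 1) ^ n * (Q - 1) ^ Suc n / of_nat (Suc n))"

definition padic_pow ::
  "'a::{field_char_0, complete_space} \<Rightarrow> 'a \<Rightarrow> 'a" where
  "padic_pow Q z = padic_exp (z * padic_log Q)"

text \<open>
  \<open>qbracket q l z\<close> is \<open>[z]\<^sub>Q\<close> for \<open>Q = q ^ l\<close>.  It is also used for \<open>z\<close> with \<open>l * z\<close>, but not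
  necessarily \<open>z\<close>, in \<open>\<int>\<^sub>p\<close>; hence \<open>Q\<close> to the power \<open>z\<close> is read as \<open>q\<close> to the power \<open>l * z\<close>.
  At \<open>Q = 1\<close>, where the quotient is 0/0, the bracket has its limit value \<open>z\<close>.
\<close>

definition qbracket ::
  "'a::{field_char_0, complete_space} \<Rightarrow> nat \<Rightarrow> 'a \<Rightarrow> 'a" where
  "qbracket q l z =
     (if q ^ l = 1 then z else (1 - padic_pow q (of_nat l * z)) / (1 - q ^ l))"

definition qbracket_minus ::
  "'a::{field_char_0, complete_space} \<Rightarrow> nat \<Rightarrow> 'a" where
  "qbracket_minus q l = (1 - (- q) ^ l) / (1 + q)"

definition fermionic_integral ::
  "nat \<Rightarrow> 'a::{field_char_0, complete_space} \<Rightarrow> ('a \<Rightarrow> 'a) \<Rightarrow> 'a" where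
  "fermionic_integral p Q f =
     lim (\<lambda>N. (1 + Q) / (1 + Q ^ (p ^ N)) *
                (\<Sum>x<p ^ N. f (of_nat x) * (- 1) ^ x * Q ^ x))"

text \<open>
  \<open>F\<close> is a function of the variables \<open>x 1, \<dots>, x k\<close>.  The integral over \<open>x 1\<close> is the innermost one;
  the value 0 given to the coordinates outside \<open>{1..k}\<close> is immaterial.
\<close>

primrec iterated_fermionic_integral ::
  "nat \<Rightarrow> 'a::{field_char_0, complete_space} \<Rightarrow> nat \<Rightarrow> ((nat \<Rightarrow> 'a) \<Rightarrow> 'a) \<Rightarrow> 'a" where
  "iterated_fermionic_integral p Q 0 F = F (\<lambda>_. 0)"
| "iterated_fermionic_integral p Q (Suc k) F =
     fermionic_integral p Q
       (\<lambda>t. iterated_fermionic_integral p Q k (\<lambda>x. F (x(Suc k := t))))"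

text \<open>
  \<open>qEuler p q l m k y\<close> is the value at \<open>y\<close> of the polynomial \<open>E\<close> of type \<open>(0,k)\<close> and index \<open>m\<close> for
  the base \<open>Q = q ^ l\<close>; the base \<open>q\<close> itself is \<open>l = 1\<close>.  The parameters \<open>q\<close> and \<open>l\<close> are kept apart
  because of the reading of powers of \<open>q ^ l\<close> in \<open>qbracket\<close>.
\<close>

definition qEuler ::
  "nat \<Rightarrow> 'a::{field_char_0, complete_space} \<Rightarrow> nat \<Rightarrow> nat \<Rightarrow> nat \<Rightarrow> 'a \<Rightarrow> 'a" where
  "qEuler p q l m k y =
     iterated_fermionic_integral p (q ^ l) k
       (\<lambda>x. qbracket q l (y + (\<Sum>j=1..k. x j)) ^ m *
             padic_pow (q ^ l) (- (\<Sum>j=1..k. of_nat j * x j)))"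

end

theory Submission
  imports Defs
begin

text \<open>
  Put \<open>Q = q ^ l\<close>.  Integrating out \<open>x\<^sub>j\<close> turns a function \<open>\<phi>\<close> of \<open>n = l * (y + x\<^sub>j + \<dots> + x\<^sub>k) - x\<close> into the solution
  \<open>\<psi>\<close> of \<open>\<psi> n + Q\<^bsup>1-j\<^esup> * \<psi> (n + l) = (1 + Q) * \<phi> n\<close>: with \<open>g t = \<psi> (n + l * t) * Q\<^bsup>-jt\<^esup>\<close> the sums defining the
  integral telescope to \<open>(g 0 + Q ^ M * g M) / (1 + Q ^ M)\<close>, \<open>M = p ^ N\<close>, which tends to \<open>g 0 = \<psi> n\<close>.  Since
  \<open>[x + n]\<^sub>q\<close> is affine in the \<open>q\<close>-integer \<open>[n]\<^sub>q\<close> and \<open>[n + l]\<^sub>q = [l]\<^sub>q + Q * [n]\<^sub>q\<close>, all these functions are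
  polynomials in \<open>[n]\<^sub>q\<close>; this treats \<open>q = 1\<close> and \<open>q \<noteq> 1\<close> alike.

  If \<open>\<psi>\<close> solves the equation with step \<open>l\<close> and base \<open>Q\<close>, then, \<open>l\<close> being odd,
  \<open>(1 + q) / (1 + Q) * (\<Sum>i<l. (-1) ^ i * q\<^bsup>(1-j)i\<^esup> * \<psi> (n + i))\<close> telescopes to a solution with step 1 and base \<open>q\<close>.
  Doing this for every variable gives the theorem.

  That \<open>padic_pow\<close> extends integer powers rests on \<open>exp (log q) = q\<close>.  To see this, let \<open>w = exp (log q) / q\<close>; for
  \<open>M = p ^ N\<close> both \<open>exp (M * log q)\<close> and \<open>q ^ M\<close> equal \<open>1 + M * log q\<close> up to an error of size \<open>\<bar>M\<bar>\<^sup>2\<close>, so that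
  \<open>\<bar>M\<bar> * \<bar>w - 1\<bar> = \<bar>w ^ M - 1\<bar> \<le> \<bar>M\<bar>\<^sup>2\<close>, whence \<open>w = 1\<close>.
\<close>

subsection \<open>Functional equations\<close>

lemma minus_of_nat_powi: "(a :: 'b::field) powi (- int n) = inverse (a ^ n)"
  by (simp add: power_int_minus)

text \<open>On polynomials the operator on the left-hand side is triangular with respect to the degree.\<close>

lemma affine_functional_equation_monom:
  fixes a b c :: "'b::field"
  assumes "\<And>r::nat. 1 + a * c ^ r \<noteq> 0"
  shows "\<exists>P. \<forall>y. poly P y + a * poly P (b + c * y) = y ^ d"
proof (induction d rule: less_induct)
  case (less d)
  then obtain P where P: "poly (P r) y + a * poly (P r) (b + c * y) = y ^ r" if "r < d" for r y
    by metis
  \<comment> \<open>\<open>w r\<close> is the coefficient of \<open>y ^ r\<close> in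
    \<open>a * (b + c * y) ^ d\<close>; the top one is \<open>a * c ^ d\<close>. So the operator
    maps \<open>y ^ d\<close> to \<open>(1 + a * c ^ d) * y ^ d\<close> plus lower terms, which
    \<open>S\<close> cancels by means of the solutions of lower degree.\<close>
  define w where "w r = a * of_nat (d choose r) * c ^ r * b ^ (d - r)" for r
  define S where "S = smult (inverse (1 + a * c ^ d)) (monom 1 d - (\<Sum>r<d. smult (w r) (P r)))"
  have "poly S y + a * poly S (b + c * y) = y ^ d" for y
  proof -
    have "a * (b + c * y) ^ d = (\<Sum>r\<le>d. w r * y ^ r)"
      by (simp add: w_def add.commute[of b] binomial_ring sum_distrib_left power_mult_distrib mult_ac)
    also have "\<dots> = (\<Sum>r<d. w r * y ^ r) + a * c ^ d * y ^ d"
      by (simp add: w_def lessThan_Suc_atMost[symmetric])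
    also have "(\<Sum>r<d. w r * y ^ r)
        = (\<Sum>r<d. w r * poly (P r) y) + a * (\<Sum>r<d. w r * poly (P r) (b + c * y))"
      unfolding sum_distrib_left sum.distrib[symmetric]
      by (intro sum.cong) (auto simp: P[symmetric] algebra_simps)
    finally have affine: "a * (b + c * y) ^ d = (\<Sum>r<d. w r * poly (P r) y)
        + a * (\<Sum>r<d. w r * poly (P r) (b + c * y)) + a * c ^ d * y ^ d" .
    have S: "(1 + a * c ^ d) * poly S z = z ^ d - (\<Sum>r<d. w r * poly (P r) z)" for z
      using assms[of d] by (simp add: S_def poly_sum poly_monom)
    have "(1 + a * c ^ d) * (poly S y + a * poly S (b + c * y))
        = (1 + a * c ^ d) * poly S y + a * ((1 + a * c ^ d) * poly S (b + c * y))"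
      by (simp add: algebra_simps)
    also have "\<dots> = (1 + a * c ^ d) * y ^ d"
      unfolding S right_diff_distrib affine by (simp add: algebra_simps)
    finally have "(1 + a * c ^ d) * (poly S y + a * poly S (b + c * y)) = (1 + a * c ^ d) * y ^ d" .
    then show ?thesis using assms[of d] by simp
  qed
  then show ?case by blast
qed

lemma affine_functional_equation:
  fixes a b c :: "'b::field"
  assumes "\<And>r::nat. 1 + a * c ^ r \<noteq> 0"
  shows "\<exists>P. \<forall>y. poly P y + a * poly P (b + c * y) = poly R y"
proof -
  obtain P where P: "poly (P d) y + a * poly (P d) (b + c * y) = y ^ d" for d y
    using affine_functional_equation_monom[OF assms] by metis
  have "poly (\<Sum>d\<le>degree R. smult (coeff R d) (P d)) y
      + a * poly (\<Sum>d\<le>degree R. smult (coeff R d) (P d)) (b + c * y) = poly R y" for y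
    by (simp add: poly_sum poly_altdef[of R] P[symmetric] algebra_simps sum.distrib sum_distrib_left)
  then show ?thesis by blast
qed

text \<open>The multiple sum of the theorem as an operator on functions of \<open>n\<close>: the
  summand sees the indices only through a shift of \<open>n\<close>, so the sum can be treated one
  index at a time.\<close>

definition shift_average ::
  "'b::field \<Rightarrow> nat \<Rightarrow> nat \<Rightarrow> (nat \<Rightarrow> 'b) \<Rightarrow> nat \<Rightarrow> 'b" where
  "shift_average q l k f n =
     (\<Sum>i \<in> {1..k} \<rightarrow>\<^sub>E {0..<l}.
        q powi (- int (\<Sum>j=2..k. (j - 1) * i j)) * (- 1) ^ (\<Sum>j=1..k. i j) *
        f (n + (\<Sum>j=1..k. i j)))"

lemma shift_average_0: "shift_average q l 0 f n = f n"
  by (simp add: shift_average_def)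

lemma shift_average_add:
  "shift_average q l k (\<lambda>n. f n + g n) n = shift_average q l k f n + shift_average q l k g n"
  by (simp only: shift_average_def sum.distrib distrib_left)

lemma shift_average_mult:
  "shift_average q l k (\<lambda>n. c * f n) n = c * shift_average q l k f n"
  by (simp only: shift_average_def sum_distrib_left mult.left_commute[of c])

lemma shift_average_shift:
  "shift_average q l k (\<lambda>n. f (n + d)) n = shift_average q l k f (n + d)"
  by (simp only: shift_average_def add.assoc add.commute[of d])

text \<open>Peeling off the last index \<open>t\<close>: it shifts \<open>n\<close> by
  \<open>t\<close> and multiplies the weight by \<open>(- 1) ^ t\<close> and by \<open>q\<close> to
  the power \<open>- k * t\<close>.\<close>

lemma shift_average_Suc:
  assumes "q \<noteq> 0"
  shows "shift_average q l (Suc k) f n =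
    (\<Sum>t<l. (- (q powi (- int k))) ^ t * shift_average q l k f (n + t))"
proof -
  let ?w = "\<lambda>k i. q powi (- int (\<Sum>j=2..k. (j - 1) * i j)) * (- 1) ^ (\<Sum>j=1..k. i j)"
  let ?upd = "\<lambda>(t, i). i(Suc k := t)"
  have Suck: "{1..Suc k} = insert (Suc k) {1..k}" by auto
  have inj: "inj_on ?upd ({0..<l} \<times> ({1..k} \<rightarrow>\<^sub>E {0..<l}))"
    by (intro inj_combinator) auto
  have step: "?w (Suc k) (i(Suc k := t)) = (- (q powi (- int k))) ^ t * ?w k i" for i t
  proof -
    have "(\<Sum>j=2..Suc k. (j - 1) * (i(Suc k := t)) j) = (\<Sum>j=2..k. (j - 1) * i j) + k * t"
      \<comment> \<open>For \<open>k = 0\<close> the range \<open>{2..Suc k}\<close> is empty, in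
        agreement with \<open>k * t = 0\<close>.\<close>
      by (cases "k = 0") (auto intro!: sum.cong)
    moreover have "(\<Sum>j=1..Suc k. (i(Suc k := t)) j) = (\<Sum>j=1..k. i j) + t"
      by (auto intro!: sum.cong)
    moreover have "(- (q powi (- int k))) ^ t = (- 1) ^ t * inverse (q ^ (k * t))"
      by (subst power_minus) (simp add: power_int_minus power_inverse power_mult)
    ultimately show ?thesis
      by (simp add: minus_of_nat_powi power_add mult_ac
          del: of_nat_add of_nat_mult of_nat_Suc fun_upd_apply sum.cl_ivl_Suc of_nat_sum)
  qed
  have "shift_average q l (Suc k) f n =
    (\<Sum>(t, i)\<in>{0..<l} \<times> ({1..k} \<rightarrow>\<^sub>E {0..<l}).
      ?w (Suc k) (i(Suc k := t)) * f (n + (\<Sum>j=1..Suc k. (i(Suc k := t)) j)))"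
    unfolding shift_average_def Suck PiE_insert_eq
    by (subst sum.reindex[OF inj]) (simp add: case_prod_unfold Suck del: fun_upd_apply)
  also have "\<dots> = (\<Sum>(t, i)\<in>{0..<l} \<times> ({1..k} \<rightarrow>\<^sub>E {0..<l}).
      (- (q powi (- int k))) ^ t * (?w k i * f (n + t + (\<Sum>j=1..k. i j))))"
    unfolding step by (intro sum.cong) (auto simp: add_ac mult_ac)
  also have "\<dots> = (\<Sum>t<l. (- (q powi (- int k))) ^ t * shift_average q l k f (n + t))"
    by (simp add: shift_average_def sum_distrib_left sum.cartesian_product lessThan_atLeast0)
  finally show ?thesis .
qed

text \<open>The sum over the last index is geometric with ratio \<open>- ?a\<close>, so adding
  \<open>?a\<close> times its shift by 1 leaves only the terms at \<open>n\<close> and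
  \<open>n + l\<close>. As \<open>l\<close> is odd, the latter has coefficient
  \<open>?a ^ l\<close>, exactly the one in the equation with step \<open>l\<close>.\<close>

lemma shift_average_telescope:
  fixes q :: "'b::field"
  assumes q: "q \<noteq> 0" and l: "odd l"
    and eq: "\<And>n. f n + (q ^ l) powi (- int k) * f (n + l) = c * g n"
  shows "shift_average q l (Suc k) f n + q powi (- int k) * shift_average q l (Suc k) f (n + 1)
    = c * shift_average q l k g n"
proof -
  let ?a = "q powi (- int k)" and ?F = "shift_average q l k f"
  have "shift_average q l (Suc k) f n + ?a * shift_average q l (Suc k) f (n + 1)
    = (\<Sum>t<l. (- ?a) ^ t * ?F (n + t) - (- ?a) ^ Suc t * ?F (n + Suc t))"
    by (simp add: shift_average_Suc[OF q] sum.distrib sum_distrib_left mult_ac)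
  also have "\<dots> = ?F n - (- ?a) ^ l * ?F (n + l)"
    by (subst sum_lessThan_telescope') simp
  also have "\<dots> = ?F n + (q ^ l) powi (- int k) * ?F (n + l)"
    using l by (simp add: power_int_minus power_inverse power_mult[symmetric] mult.commute)
  also have "\<dots> = shift_average q l k (\<lambda>n. f n + (q ^ l) powi (- int k) * f (n + l)) n"
    by (simp add: shift_average_add shift_average_mult shift_average_shift)
  also have "\<dots> = c * shift_average q l k g n"
    unfolding eq by (rule shift_average_mult)
  finally show ?thesis .
qed

subsection \<open>The absolute value\<close>

locale odd_padic_complex =
  fixes p :: nat and ty :: "'a::{field_char_0, complete_space} itself"
  assumes is_padic: "is_padic_complex p ty" and odd_p: "odd p"
begin

lemma prime_p: "prime p"
  using is_padic by (simp add: is_padic_complex_def)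

lemma p_gt_2: "p > 2"
  using prime_p odd_p prime_ge_2_nat[of p] by (cases "p = 2") auto

lemma pabs_mult: "pabs (x * y :: 'a) = pabs x * pabs y"
  using is_padic by (simp add: is_padic_complex_def)

lemma pabs_p: "pabs (of_nat p :: 'a) = 1 / real p"
  using is_padic by (simp add: is_padic_complex_def)

lemma dist_pabs: "dist x y = pabs (x - y :: 'a)"
  using is_padic by (simp add: is_padic_complex_def)

lemma pabs_nonneg [simp]: "pabs (x :: 'a) \<ge> 0"
  by (simp add: pabs_def)

lemma pabs_0 [simp]: "pabs (0 :: 'a) = 0"
  by (simp add: pabs_def)

lemma pabs_eq_0 [simp]: "pabs (x :: 'a) = 0 \<longleftrightarrow> x = 0"
  by (simp add: pabs_def)

lemma pabs_le_0 [simp]: "pabs (x :: 'a) \<le> 0 \<longleftrightarrow> x = 0"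
  by (simp add: pabs_def)

lemma pabs_pos [simp]: "pabs (x :: 'a) > 0 \<longleftrightarrow> x \<noteq> 0"
  by (simp add: pabs_def)

lemma pabs_1 [simp]: "pabs (1 :: 'a) = 1"
  using pabs_mult[of 1 1] pabs_eq_0[of 1] by auto

lemma pabs_power: "pabs (x ^ n :: 'a) = pabs x ^ n"
  by (induction n) (auto simp: pabs_mult)

lemma pabs_minus_commute: "pabs (x - y :: 'a) = pabs (y - x)"
  using dist_pabs[of x y] dist_pabs[of y x] by (simp add: dist_commute)

lemma pabs_minus [simp]: "pabs (- x :: 'a) = pabs x"
  using pabs_minus_commute[of 0 x] by simp

lemma pabs_add_le: "pabs (x :: 'a) \<le> c \<Longrightarrow> pabs y \<le> c \<Longrightarrow> pabs (x + y) \<le> c"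
  using is_padic unfolding is_padic_complex_def by (meson max.boundedI order_trans)

lemma pabs_diff_le: "pabs (x :: 'a) \<le> c \<Longrightarrow> pabs y \<le> c \<Longrightarrow> pabs (x - y) \<le> c"
  using pabs_add_le[of x c "- y"] by simp

lemma pabs_add_less: "pabs (x :: 'a) < c \<Longrightarrow> pabs y < c \<Longrightarrow> pabs (x + y) < c"
  using pabs_add_le[of x "max (pabs x) (pabs y)" y] by auto

lemma pabs_sum_le:
  fixes f :: "'b \<Rightarrow> 'a"
  shows "(\<And>i. i \<in> A \<Longrightarrow> pabs (f i) \<le> c) \<Longrightarrow> c \<ge> 0 \<Longrightarrow> pabs (sum f A) \<le> c"
  by (induction A rule: infinite_finite_induct) (auto intro: pabs_add_le)

text \<open>Every triangle is isosceles for an ultrametric: \<open>pabs x < pabs y\<close> would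
  force \<open>pabs y < pabs y\<close>.\<close>

lemma pabs_eq_if_close: "pabs (x - y :: 'a) < pabs y \<Longrightarrow> pabs x = pabs y"
  using pabs_add_less[of "x - y" "pabs y" "- x"] pabs_add_le[of "x - y" "pabs y" y] by force

lemma pabs_inverse: "pabs (inverse x :: 'a) = inverse (pabs x)"
  using pabs_mult[of x "inverse x"] by (cases "x = 0") (auto simp: field_simps)

lemma pabs_divide: "pabs (x / y :: 'a) = pabs x / pabs y"
  by (simp add: divide_inverse pabs_mult pabs_inverse)

lemma pabs_of_nat_le_1 [simp]: "pabs (of_nat n :: 'a) \<le> 1"
  by (induction n) (auto intro: pabs_add_le)

text \<open>By Bezout, \<open>u * n = 1 - v * p\<close>. The last term is smaller than 1 in absolute
  value, so \<open>u * n\<close> is a unit; neither factor exceeds 1, so both are units.\<close>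

lemma pabs_of_nat_coprime:
  assumes "\<not> p dvd n"
  shows "pabs (of_nat n :: 'a) = 1"
proof -
  have "coprime (int n) (int p)"
    using assms prime_p by (metis coprime_commute coprime_int_iff prime_imp_coprime)
  then obtain u v where uv: "u * int n + v * int p = 1"
    by (metis bezout_int coprime_imp_gcd_eq_1)
  have le1: "pabs (of_int z :: 'a) \<le> 1" for z
    using pabs_of_nat_le_1 by (cases z rule: int_cases2) auto
  have "(of_int (u * int n + v * int p) :: 'a) = 1"
    unfolding uv by simp
  then have "1 - of_int u * of_nat n = (of_int v * of_nat p :: 'a)"
    by (simp add: algebra_simps)
  moreover have "pabs (of_int v * of_nat p :: 'a) < 1"
    using mult_left_le_one_le[of "1 / real p" "pabs (of_int v :: 'a)"] le1[of v] p_gt_2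
    by (simp add: pabs_mult pabs_p)
  ultimately have "pabs (of_int u * of_nat n :: 'a) = 1"
    using pabs_eq_if_close[of "of_int u * of_nat n" 1] by (simp add: pabs_minus_commute)
  then show ?thesis
    using le1[of u] pabs_of_nat_le_1[of n]
    by (metis mult_left_le_one_le mult.commute order_antisym pabs_mult pabs_nonneg)
qed

text \<open>For odd \<open>p\<close> the number 2 is a unit, and hence so is \<open>1 + Q\<close>
  for \<open>Q\<close> close to 1: these are the denominators of the fermionic integral.\<close>

lemma pabs_2: "pabs (2 :: 'a) = 1"
  using pabs_of_nat_coprime[of 2] p_gt_2 dvd_imp_le[of p 2] by auto

subsection \<open>Exponential and logarithm\<close>

text \<open>The radius of convergence of the exponential series.\<close>

definition radius :: real where
  "radius = real p powr (- 1 / (real p - 1))"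

lemma radius_pos: "radius > 0"
  using p_gt_2 by (simp add: radius_def)

lemma radius_less_1: "radius < 1"
  unfolding radius_def using p_gt_2 by (intro powr_less_one) (auto simp: field_simps)

lemma radius_power: "radius ^ (p - 1) = 1 / real p"
proof -
  have "radius ^ (p - 1) = real p powr (- 1 / (real p - 1) * real (p - 1))"
    using p_gt_2 by (simp add: radius_def powr_powr flip: powr_realpow)
  also have "\<dots> = real p powr (- 1)"
    using p_gt_2 by (simp add: of_nat_diff)
  finally show ?thesis
    using p_gt_2 by (simp add: powr_minus_divide)
qed

text \<open>Legendre's formula in recursive form: the multiples of \<open>p\<close> up to
  \<open>n\<close> are \<open>p * 1, ..., p * (n div p)\<close>, and all other factors of the
  factorial are units.\<close>

lemma pabs_fact: "pabs (fact n :: 'a) = (1 / real p) ^ (n div p) * pabs (fact (n div p) :: 'a)"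
proof (induction n)
  case (Suc n)
  show ?case
  proof (cases "p dvd Suc n")
    case True
    then obtain m where m: "Suc n = p * m" by blast
    then obtain m' where m': "m = Suc m'" by (cases m) auto
    have "Suc n div p = Suc m'" using m m' p_gt_2 by simp
    moreover have "n div p = m'"
    proof -
      have "n = (p - 1) + m' * p" using m m' p_gt_2 by (simp add: algebra_simps)
      then have "n div p = (p - 1) div p + m'"
        using p_gt_2 by (simp only: div_mult_self1)
      then show ?thesis using p_gt_2 by simp
    qed
    moreover have "pabs (fact (Suc n) :: 'a) = pabs (of_nat (Suc n) :: 'a) * pabs (fact n :: 'a)"
      by (simp add: pabs_mult del: of_nat_Suc)
    moreover have "pabs (of_nat (Suc n) :: 'a) = 1 / real p * pabs (of_nat (Suc m') :: 'a)"
      unfolding m m' by (simp only: of_nat_mult pabs_mult pabs_p)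
    moreover have "pabs (fact (Suc m') :: 'a) = pabs (of_nat (Suc m') :: 'a) * pabs (fact m' :: 'a)"
      by (simp add: pabs_mult del: of_nat_Suc)
    ultimately show ?thesis
      using Suc.IH by (simp del: of_nat_Suc fact_Suc)
  next
    case False
    then have "Suc n div p = n div p"
      by (simp add: div_Suc dvd_eq_mod_eq_0)
    then show ?thesis
      using Suc.IH pabs_of_nat_coprime[OF False] by (simp add: pabs_mult del: of_nat_Suc)
  qed
qed simp

text \<open>This is the bound \<open>(n - 1) / (p - 1)\<close> for the exponent of \<open>p\<close>
  in the factorial of \<open>n\<close>, read off from the recursion
  \<open>pabs_fact\<close>.\<close>

lemma pabs_fact_ge: "n > 0 \<Longrightarrow> pabs (fact n :: 'a) \<ge> radius ^ (n - 1)"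
proof (induction n rule: less_induct)
  case (less n)
  show ?case
  proof (cases "n div p = 0")
    case True
    then show ?thesis
      using radius_pos radius_less_1 by (simp add: pabs_fact[of n] power_le_one)
  next
    case False
    let ?m = "n div p"
    have m: "0 < ?m" "?m < n"
      using False p_gt_2 less.prems by auto
    have "?m * p \<le> n" by simp
    \<comment> \<open>The left-hand side is \<open>p * ?m - 1\<close>.\<close>
    then have exp_le: "(p - 1) * ?m + (?m - 1) \<le> n - 1"
      using m p_gt_2 by (cases p; simp add: algebra_simps)
    have "radius ^ (n - 1) \<le> radius ^ ((p - 1) * ?m + (?m - 1))"
      using radius_pos radius_less_1 exp_le by (intro power_decreasing) auto
    also have "\<dots> = (1 / real p) ^ ?m * radius ^ (?m - 1)"
      by (simp only: power_add power_mult radius_power)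
    also have "\<dots> \<le> (1 / real p) ^ ?m * pabs (fact ?m :: 'a)"
      using less.IH[OF m(2) m(1)] by (intro mult_left_mono) auto
    finally show ?thesis by (simp add: pabs_fact[of n])
  qed
qed

text \<open>The leading factor \<open>radius\<close> stems from the exponent \<open>n - 1\<close> in
  \<open>pabs_fact_ge\<close>; thanks to it no term with \<open>n > 0\<close> exceeds
  \<open>pabs z\<close> inside the disc.\<close>

lemma pabs_exp_term_le:
  assumes "n > 0" "pabs (z :: 'a) \<le> s"
  shows "pabs (z ^ n / fact n) \<le> radius * (s / radius) ^ n"
proof -
  have "pabs (z ^ n / fact n) \<le> s ^ n / radius ^ (n - 1)"
    unfolding pabs_divide pabs_power
    using assms pabs_fact_ge[OF assms(1)] radius_pos
    by (intro frac_le power_mono zero_le_power) (auto intro: order_trans[OF pabs_nonneg])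
  also have "\<dots> = radius * (s / radius) ^ n"
    using assms radius_pos by (cases n) (auto simp: field_simps)
  finally show ?thesis .
qed

lemma pabs_exp_term_le_power:
  assumes "pabs (z :: 'a) \<le> s"
  shows "pabs (z ^ n / fact n) \<le> (s / radius) ^ n"
proof (cases "n = 0")
  case False
  have "s \<ge> 0" using assms pabs_nonneg order_trans by blast
  then have "radius * (s / radius) ^ n \<le> 1 * (s / radius) ^ n"
    using radius_pos radius_less_1 by (intro mult_right_mono) auto
  then show ?thesis
    using pabs_exp_term_le[of n z s] assms False by simp
qed simp

lemma pabs_exp_term_le_arg:
  assumes "n > 0" "pabs (z :: 'a) < radius"
  shows "pabs (z ^ n / fact n) \<le> pabs z"
proof -
  have "(pabs z / radius) ^ n \<le> (pabs z / radius) ^ 1"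
    using assms radius_pos by (intro power_decreasing) auto
  then have "radius * (pabs z / radius) ^ n \<le> pabs z"
    using radius_pos by (simp add: field_simps)
  then show ?thesis
    using pabs_exp_term_le[of n z "pabs z"] assms by simp
qed

section \<open>Ultrametric series and the exponential function\<close>

lemma tendsto_iff_pabs: "((X :: nat \<Rightarrow> 'a) \<longlongrightarrow> L) F \<longleftrightarrow> ((\<lambda>n. pabs (X n - L)) \<longlongrightarrow> 0) F"
  by (subst tendsto_dist_iff) (simp add: dist_pabs)

lemma pabs_limit_le:
  assumes "X \<longlonglongrightarrow> (L :: 'a)" "eventually (\<lambda>n. pabs (X n - y) \<le> c) sequentially"
  shows "pabs (L - y) \<le> c"
  using tendsto_upperbound[OF tendsto_dist[OF assms(1) tendsto_const[of y]], of c] assms(2)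
  by (simp add: dist_pabs)

text \<open>A finite ultrametric sum is at most its largest term, so each tail is bounded by the
  bound of its first term, with no factor \<open>1 / (1 - s)\<close>.\<close>

lemma geometric_bound_sums:
  fixes f :: "nat \<Rightarrow> 'a"
  assumes bound: "\<And>n. pabs (f n) \<le> s ^ n" and s: "0 \<le> s" "s < 1"
  shows "f sums suminf f" "pabs (suminf f - sum f {..<N}) \<le> s ^ N"
proof -
  have tail: "pabs (sum f {..<n} - sum f {..<m}) \<le> s ^ m" if "m \<le> n" for m n
  proof -
    have "sum f {..<n} - sum f {..<m} = sum f {m..<n}"
      using that sum_diff_nat_ivl[of 0 m n f] by (simp add: lessThan_atLeast0)
    also have "pabs \<dots> \<le> s ^ m"
      using s by (intro pabs_sum_le order_trans[OF bound] power_decreasing) auto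
    finally show ?thesis .
  qed
  have "Cauchy (\<lambda>n. sum f {..<n})"
  proof (rule metric_CauchyI)
    fix e :: real assume "e > 0"
    then obtain M where M: "s ^ M < e"
      using s real_arch_pow_inv by blast
    have "dist (sum f {..<m}) (sum f {..<n}) < e" if "m \<ge> M" "n \<ge> M" for m n
    proof -
      have "pabs (sum f {..<m} - sum f {..<M} - (sum f {..<n} - sum f {..<M})) \<le> s ^ M"
        using that by (intro pabs_diff_le tail)
      then show ?thesis using M by (simp add: dist_pabs)
    qed
    then show "\<exists>M. \<forall>m\<ge>M. \<forall>n\<ge>M. dist (sum f {..<m}) (sum f {..<n}) < e" by blast
  qed
  then have "summable f"
    by (metis Cauchy_convergent summable_iff_convergent)
  then show sums: "f sums suminf f"
    by (rule summable_sums)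
  show "pabs (suminf f - sum f {..<N}) \<le> s ^ N"
    using sums tail unfolding sums_def
    by (intro pabs_limit_le[where X = "\<lambda>n. sum f {..<n}"]) (auto simp: eventually_at_top_linorder)
qed

text \<open>The bound \<open>s\<close> is separate from \<open>pabs z\<close> so that
  \<open>a\<close>, \<open>b\<close> and \<open>a + b\<close> can share one error estimate in
  \<open>padic_exp_add\<close>.\<close>

lemma exp_sums:
  assumes "pabs (z :: 'a) \<le> s" "s < radius"
  shows "(\<lambda>n. z ^ n / fact n) sums padic_exp z"
    and "pabs (padic_exp z - (\<Sum>n<N. z ^ n / fact n)) \<le> (s / radius) ^ N"
proof -
  have s: "0 \<le> s / radius" "s / radius < 1"
    using assms radius_pos order_trans[OF pabs_nonneg] by auto
  show "(\<lambda>n. z ^ n / fact n) sums padic_exp z"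
    "pabs (padic_exp z - (\<Sum>n<N. z ^ n / fact n)) \<le> (s / radius) ^ N"
    unfolding padic_exp_def
    using geometric_bound_sums[OF pabs_exp_term_le_power[OF assms(1)] s] by auto
qed

lemma pabs_exp_minus_1_le:
  assumes "pabs (z :: 'a) < radius"
  shows "pabs (padic_exp z - 1) \<le> pabs z"
proof -
  have *: "pabs ((\<Sum>n<N. z ^ n / fact n) - 1) \<le> pabs z" if "N \<ge> 1" for N
  proof -
    have "(\<Sum>n<N. z ^ n / fact n) - 1 = (\<Sum>n\<in>{1..<N}. z ^ n / fact n)"
      using that by (simp add: lessThan_atLeast0 sum.atLeast_Suc_lessThan)
    also have "pabs \<dots> \<le> pabs z"
      using assms by (intro pabs_sum_le pabs_exp_term_le_arg) auto
    finally show ?thesis .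
  qed
  show ?thesis
    using exp_sums(1)[OF order_refl assms] *
    unfolding sums_def by (intro pabs_limit_le) (auto simp: eventually_at_top_linorder)
qed

lemma padic_exp_0: "padic_exp (0 :: 'a) = 1"
  using pabs_exp_minus_1_le[of 0] radius_pos by simp

lemma pabs_exp:
  assumes "pabs (z :: 'a) < radius"
  shows "pabs (padic_exp z) = 1"
  using pabs_eq_if_close[of "padic_exp z" 1] pabs_exp_minus_1_le[OF assms] assms radius_less_1
  by simp

text \<open>By the binomial theorem the partial sum for \<open>a + b\<close> collects the products
  with \<open>i + j < N\<close>. What remains of the full square has \<open>i + j \<ge> N\<close>,
  so every remaining term is small.\<close>

lemma exp_partial_sum_mult:
  fixes a b :: 'a
  assumes "pabs a \<le> s" "pabs b \<le> s" "s < radius"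
  shows "pabs ((\<Sum>n<N. a ^ n / fact n) * (\<Sum>n<N. b ^ n / fact n)
    - (\<Sum>n<N. (a + b) ^ n / fact n)) \<le> (s / radius) ^ N"
proof -
  let ?g = "\<lambda>i j. a ^ i / fact i * (b ^ j / fact j)"
  have s: "0 \<le> s / radius" "s / radius \<le> 1"
    using assms radius_pos order_trans[OF pabs_nonneg] by auto
  have power: "(a + b) ^ n / fact n = (\<Sum>i\<le>n. ?g i (n - i))" for n
  proof -
    have "(a + b) ^ n / fact n = (\<Sum>i\<le>n. of_nat (n choose i) * a ^ i * b ^ (n - i) / fact n)"
      by (simp add: binomial_ring sum_divide_distrib)
    also have "\<dots> = (\<Sum>i\<le>n. ?g i (n - i))"
      by (intro sum.cong) (auto simp: binomial_fact field_simps)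
    finally show ?thesis .
  qed
  let ?T = "{(i, j). i + j < N}" and ?S = "{..<N} \<times> {..<N}"
  have "?T \<subseteq> ?S" by auto
  then have "(\<Sum>n<N. a ^ n / fact n) * (\<Sum>n<N. b ^ n / fact n) - (\<Sum>n<N. (a + b) ^ n / fact n)
      = (\<Sum>(i,j)\<in>?S - ?T. ?g i j)"
    by (simp only: sum_product sum.cartesian_product power sum.triangle_reindex[of ?g N, symmetric] sum_diff
        finite_cartesian_product finite_lessThan)
  also have "pabs \<dots> \<le> (s / radius) ^ N"
  proof (rule pabs_sum_le)
    fix x assume x: "x \<in> ?S - ?T"
    obtain i j where ij: "x = (i, j)" by fastforce
    have "pabs (?g i j) \<le> (s / radius) ^ i * (s / radius) ^ j"
      unfolding pabs_mult
      using s assms by (intro mult_mono pabs_exp_term_le_power) auto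
    also have "\<dots> \<le> (s / radius) ^ N"
      unfolding power_add[symmetric] using s x ij by (intro power_decreasing) auto
    finally show "pabs (case x of (i, j) \<Rightarrow> ?g i j) \<le> (s / radius) ^ N"
      using ij by simp
  qed (use s in auto)
  finally show ?thesis .
qed

lemma eq_if_geometrically_close:
  assumes "\<And>N :: nat. pabs (x - y :: 'a) \<le> s ^ N" "0 \<le> s" "s < 1"
  shows "x = y"
proof (rule ccontr)
  assume "x \<noteq> y"
  then have "pabs (x - y) > 0" by simp
  then obtain N where "s ^ N < pabs (x - y)"
    using assms(3) real_arch_pow_inv by blast
  then show False using assms(1)[of N] by simp
qed

lemma padic_exp_add:
  fixes a b :: 'a
  assumes "pabs a < radius" "pabs b < radius"
  shows "padic_exp (a + b) = padic_exp a * padic_exp b"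
proof -
  define s where "s = max (pabs a) (pabs b)"
  have s: "pabs a \<le> s" "pabs b \<le> s" "s < radius" "pabs (a + b) \<le> s" "s \<ge> 0"
    using assms pabs_add_le[of a s b] pabs_nonneg[of a] unfolding s_def
    by (auto intro: order_trans[OF pabs_nonneg])
  have le1: "s / radius \<le> 1" using s radius_pos by auto
  show ?thesis
  proof (rule eq_if_geometrically_close)
    fix N :: nat
    let ?A = "\<Sum>n<N. a ^ n / fact n" and ?B = "\<Sum>n<N. b ^ n / fact n"
      and ?C = "\<Sum>n<N. (a + b) ^ n / fact n"
    have A: "pabs ?A \<le> 1"
      using s radius_pos le1
      by (intro pabs_sum_le order_trans[OF pabs_exp_term_le_power[OF s(1)]] power_le_one) auto
    \<comment> \<open>Each of the four summands is an error of truncation, multiplied by a factor of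
      absolute value at most 1.\<close>
    have "padic_exp (a + b) - padic_exp a * padic_exp b =
      (padic_exp (a + b) - ?C) - (?A * ?B - ?C) - (padic_exp a - ?A) * padic_exp b
      - ?A * (padic_exp b - ?B)"
      by (simp add: algebra_simps)
    also have "pabs \<dots> \<le> (s / radius) ^ N"
    proof (rule pabs_diff_le[OF pabs_diff_le[OF pabs_diff_le]])
      show "pabs (padic_exp (a + b) - ?C) \<le> (s / radius) ^ N" using s by (intro exp_sums)
      show "pabs (?A * ?B - ?C) \<le> (s / radius) ^ N" using s by (intro exp_partial_sum_mult)
      show "pabs ((padic_exp a - ?A) * padic_exp b) \<le> (s / radius) ^ N"
        using exp_sums(2)[OF s(1) s(3)] assms by (simp add: pabs_mult pabs_exp)
      show "pabs (?A * (padic_exp b - ?B)) \<le> (s / radius) ^ N"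
        using mult_mono[OF A exp_sums(2)[OF s(2) s(3), of N]] by (simp add: pabs_mult)
    qed
    finally show "pabs (padic_exp (a + b) - padic_exp a * padic_exp b) \<le> (s / radius) ^ N" .
  qed (use s radius_pos in auto)
qed

lemma pabs_of_nat_mult_less:
  "pabs (z :: 'a) < c \<Longrightarrow> pabs (of_nat n * z) < c"
  using mult_right_mono[OF pabs_of_nat_le_1[of n] pabs_nonneg[of z]] by (simp add: pabs_mult)

lemma padic_exp_of_nat_mult:
  assumes "pabs (z :: 'a) < radius"
  shows "padic_exp (of_nat n * z) = padic_exp z ^ n"
proof (induction n)
  case (Suc n)
  then show ?case
    using padic_exp_add[OF assms pabs_of_nat_mult_less[OF assms, of n]]
    by (simp add: algebra_simps)
qed (simp add: padic_exp_0)

lemma padic_exp_minus: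
  assumes "pabs (z :: 'a) < radius"
  shows "padic_exp (- z) = inverse (padic_exp z)"
  using padic_exp_add[of z "- z"] assms padic_exp_0 by (simp add: inverse_unique)

text \<open>The \<open>q\<close>-integer \<open>[n]\<^sub>q\<close>, also meaningful at \<open>q = 1\<close>.\<close>

definition qnat :: "'a \<Rightarrow> nat \<Rightarrow> 'a" where
  "qnat q n = (\<Sum>i<n. q ^ i)"

lemma qnat_add: "qnat q (m + n) = qnat q m + q ^ m * qnat q n"
  by (induction n) (auto simp: qnat_def algebra_simps power_add)

lemma qnat_geometric: "qnat q n * (1 - q) = 1 - q ^ n"
  unfolding qnat_def by (simp add: one_diff_power_eq mult.commute)

text \<open>Expansion in powers of \<open>q - 1\<close> without division by \<open>q - 1\<close>.
  The terms with \<open>k \<ge> n\<close> vanish, so the cutoff \<open>N\<close> is free and can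
  follow the partial sums of the logarithm series.\<close>

lemma qnat_binomial: "n \<le> N \<Longrightarrow> qnat q n = (\<Sum>k<N. of_nat (n choose Suc k) * (q - 1) ^ k)"
proof (induction n)
  case (Suc n)
  have "q ^ n = ((q - 1) + 1) ^ n" by simp
  also have "\<dots> = (\<Sum>k\<le>n. of_nat (n choose k) * (q - 1) ^ k)"
    by (subst binomial_ring) simp
  also have "\<dots> = (\<Sum>k<N. of_nat (n choose k) * (q - 1) ^ k)"
    using Suc.prems by (intro sum.mono_neutral_left) auto
  finally show ?case
    using Suc by (simp add: qnat_def sum.distrib algebra_simps)
qed (simp add: qnat_def)

text \<open>Absorption extracts the factor \<open>n\<close>. The remaining coefficients resemble
  those of the logarithm, with a binomial coefficient in place of the sign.\<close>

lemma qnat_binomial':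
  assumes "n \<le> N"
  shows "qnat q n = of_nat n * (\<Sum>k<N. of_nat ((n - 1) choose k) * (q - 1) ^ k / of_nat (Suc k))"
proof -
  have "of_nat (n choose Suc k) = (of_nat n * of_nat ((n - 1) choose k) / of_nat (Suc k) :: 'a)" for k
    using binomial_absorption[of k n]
    by (metis nonzero_mult_div_cancel_left of_nat_mult of_nat_eq_0_iff nat.distinct(1))
  then show ?thesis
    using qnat_binomial[OF assms] by (simp add: sum_distrib_left mult.assoc del: of_nat_Suc)
qed

text \<open>Since \<open>Suc k\<close> divides its factorial, the estimates for the exponential
  series carry over to the logarithm series.\<close>

lemma pabs_divide_of_nat_le:
  "pabs (z / of_nat (Suc k) :: 'a) \<le> pabs (z / fact (Suc k))"
proof -
  have "fact (Suc k) = (of_nat (Suc k) * of_nat (fact k) :: 'a)" by simp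
  then have "pabs (fact (Suc k) :: 'a) \<le> pabs (of_nat (Suc k) :: 'a)"
    using mult_left_mono[OF pabs_of_nat_le_1[of "fact k"] pabs_nonneg[of "of_nat (Suc k)"]]
    by (simp add: pabs_mult del: of_nat_Suc)
  moreover have "pabs (fact (Suc k) :: 'a) > 0"
    unfolding pabs_pos by (rule fact_nonzero)
  ultimately show ?thesis
    unfolding pabs_divide by (intro divide_left_mono mult_pos_pos) auto
qed

text \<open>By \<open>qnat_binomial'\<close>, \<open>qnat q n\<close> is
  \<open>of_nat n * (1 + ?s)\<close>, where \<open>?s\<close> collects the terms with
  \<open>k \<ge> 1\<close> and is smaller than 1.\<close>

lemma pabs_qnat:
  assumes "pabs (1 - q) < radius"
  shows "pabs (qnat q n) = pabs (of_nat n :: 'a)"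
proof (cases "n = 0")
  case False
  then obtain N where N: "n = Suc N" by (cases n) auto
  define t where "t = q - 1"
  have t: "pabs t < radius" using assms by (simp add: t_def pabs_minus_commute)
  let ?s = "\<Sum>k\<in>{1..<n}. of_nat ((n - 1) choose k) * t ^ k / of_nat (Suc k)"
  have "pabs ?s \<le> pabs t / radius"
  proof (rule pabs_sum_le)
    fix k assume k: "k \<in> {1..<n}"
    have "pabs (of_nat ((n - 1) choose k) * t ^ k / of_nat (Suc k))
        \<le> pabs (t ^ k / of_nat (Suc k))"
      using mult_right_mono[OF pabs_of_nat_le_1[of "(n - 1) choose k"] pabs_nonneg[of "t ^ k / of_nat (Suc k)"]]
      by (simp add: pabs_mult pabs_divide del: of_nat_Suc)
    \<comment> \<open>The factor \<open>pabs t\<close> raises the power of \<open>t\<close> to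
      \<open>Suc k\<close>, matching the factorial in the exponential bound; it is cancelled at the
      end, apart from the case \<open>t = 0\<close>.\<close>
    then have "pabs (of_nat ((n - 1) choose k) * t ^ k / of_nat (Suc k)) * pabs t
        \<le> pabs (t ^ k / of_nat (Suc k)) * pabs t"
      by (intro mult_right_mono) auto
    also have "\<dots> \<le> (pabs t / radius) * pabs t"
    proof -
      have "pabs (t ^ k / of_nat (Suc k)) * pabs t = pabs (t ^ Suc k / of_nat (Suc k))"
        by (simp add: pabs_mult pabs_divide del: of_nat_Suc)
      also have "\<dots> \<le> pabs (t ^ Suc k / fact (Suc k))" by (rule pabs_divide_of_nat_le)
      also have "\<dots> \<le> radius * (pabs t / radius) ^ Suc k"
        by (intro pabs_exp_term_le) auto
      \<comment> \<open>Here \<open>k \<ge> 1\<close> enters, through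
        \<open>Suc k \<ge> 2\<close>.\<close>
      also have "\<dots> \<le> radius * (pabs t / radius) ^ 2"
        using k t radius_pos by (intro mult_left_mono power_decreasing) auto
      also have "\<dots> = (pabs t / radius) * pabs t"
        using radius_pos by (simp add: power2_eq_square)
      finally show ?thesis .
    qed
    finally show "pabs (of_nat ((n - 1) choose k) * t ^ k / of_nat (Suc k)) \<le> pabs t / radius"
      using k by (cases "t = 0") (auto simp del: of_nat_Suc times_divide_eq_left)
  qed (use radius_pos in auto)
  then have "pabs ?s < 1"
    using t radius_pos by (smt (verit) divide_less_eq_1)
  then have "pabs (1 + ?s) = 1"
    using pabs_eq_if_close[of "1 + ?s" 1] by simp
  moreover have "qnat q n = of_nat n * (1 + ?s)"
    using qnat_binomial'[of n n q] False
    by (simp add: t_def lessThan_atLeast0 sum.atLeast_Suc_lessThan)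
  ultimately show ?thesis by (simp add: pabs_mult)
qed (simp add: qnat_def)

lemma pabs_1_minus_power:
  assumes "pabs (1 - q :: 'a) < radius"
  shows "pabs (1 - q ^ n) = pabs (of_nat n :: 'a) * pabs (1 - q)"
  using pabs_qnat[OF assms, of n] qnat_geometric[of q n] by (metis pabs_mult)

section \<open>The logarithm as inverse of the exponential\<close>

lemma log_sums:
  assumes "pabs (1 - q :: 'a) < radius"
  shows "(\<lambda>n. (- 1) ^ n * (q - 1) ^ Suc n / of_nat (Suc n)) sums padic_log q"
    and "pabs (padic_log q) \<le> pabs (1 - q)"
proof -
  let ?f = "\<lambda>n. (- 1) ^ n * (q - 1) ^ Suc n / of_nat (Suc n)"
  define t where "t = q - 1"
  have t: "pabs t < radius" using assms by (simp add: t_def pabs_minus_commute)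
  have *: "pabs (?f n) \<le> pabs (t ^ Suc n / fact (Suc n))" for n
    using pabs_divide_of_nat_le[of "t ^ Suc n" n]
    by (simp add: t_def pabs_mult pabs_divide pabs_power del: of_nat_Suc fact_Suc power_Suc)
  have "(pabs t / radius) ^ Suc n \<le> (pabs t / radius) ^ n" for n
    using t radius_pos by (intro power_decreasing) auto
  then have "pabs (?f n) \<le> (pabs t / radius) ^ n" for n
    using * pabs_exp_term_le_power[OF order_refl, of t "Suc n"] by (meson order_trans)
  from geometric_bound_sums(1)[OF this] show sums: "?f sums padic_log q"
    using t radius_pos by (simp add: padic_log_def)
  have "pabs (sum ?f {..<N} - 0) \<le> pabs t" for N
    unfolding diff_0_right
    using t by (intro pabs_sum_le order_trans[OF *] pabs_exp_term_le_arg) auto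
  then have "pabs (padic_log q - 0) \<le> pabs t"
    using sums unfolding sums_def by (intro pabs_limit_le) auto
  then show "pabs (padic_log q) \<le> pabs (1 - q)"
    by (simp add: t_def pabs_minus_commute)
qed

text \<open>Measures how close the coefficients of \<open>(q ^ M - 1) / M\<close> are to those of
  the logarithm. By Pascal's rule the deviation at \<open>Suc k\<close> is
  \<open>M choose Suc k\<close> minus the deviation at \<open>k\<close>, and absorption makes that
  binomial coefficient small.\<close>

lemma pabs_binomial_alternating:
  assumes "M > 0"
  shows "pabs (of_nat ((M - 1) choose k) - (- 1) ^ k :: 'a) \<le> pabs (of_nat M / fact k :: 'a)"
proof (induction k)
  case (Suc k)
  have le: "pabs (of_nat M / fact k :: 'a) \<le> pabs (of_nat M / fact (Suc k) :: 'a)"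
  proof -
    have "(of_nat M / fact k :: 'a) = of_nat (Suc k) * (of_nat M / fact (Suc k))"
      by (simp del: of_nat_Suc)
    then show ?thesis
      using mult_right_mono[OF pabs_of_nat_le_1[of "Suc k"] pabs_nonneg[of "of_nat M / fact (Suc k)"]]
      by (simp only: pabs_mult mult_1)
  qed
  have M: "M choose Suc k = ((M - 1) choose k) + ((M - 1) choose Suc k)"
    using assms by (cases M) auto
  have "of_nat (M choose Suc k) = (of_nat M * of_nat ((M - 1) choose k) / of_nat (Suc k) :: 'a)"
    using binomial_absorption[of k M]
    by (metis nonzero_mult_div_cancel_left of_nat_mult of_nat_eq_0_iff nat.distinct(1))
  then have "pabs (of_nat (M choose Suc k) :: 'a)
      = pabs (of_nat ((M - 1) choose k) :: 'a) * pabs (of_nat M / of_nat (Suc k) :: 'a)"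
    by (simp add: pabs_mult pabs_divide del: of_nat_Suc)
  also have "\<dots> \<le> pabs (of_nat M / of_nat (Suc k) :: 'a)"
    using mult_right_mono[OF pabs_of_nat_le_1 pabs_nonneg] by (metis mult_1)
  also have "\<dots> \<le> pabs (of_nat M / fact (Suc k) :: 'a)"
    by (rule pabs_divide_of_nat_le)
  finally have "pabs (of_nat (M choose Suc k) - (of_nat ((M - 1) choose k) - (- 1) ^ k) :: 'a)
      \<le> pabs (of_nat M / fact (Suc k) :: 'a)"
    using order_trans[OF Suc.IH le] by (rule pabs_diff_le)
  then show ?case by (simp add: M del: fact_Suc)
qed simp

text \<open>In powers of \<open>t\<close>, both \<open>(q ^ M - 1) / M\<close> and
  \<open>padic_log q\<close> are explicit series whose terms differ by at most
  \<open>pabs (of_nat M)\<close>. Multiplying by \<open>M\<close> squares this bound.\<close>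

lemma pabs_power_minus_log_le:
  assumes q: "pabs (1 - q :: 'a) < radius" and "M > 0"
  shows "pabs (q ^ M - 1 - of_nat M * padic_log q) \<le> pabs (of_nat M :: 'a) ^ 2"
proof -
  define t where "t = q - 1"
  have t: "pabs t < radius" using q by (simp add: t_def pabs_minus_commute)
  let ?f = "\<lambda>n. (- 1) ^ n * t ^ Suc n / of_nat (Suc n)"
  let ?g = "\<lambda>n. of_nat ((M - 1) choose n) * t ^ Suc n / of_nat (Suc n)"
  have diff: "pabs (?f n - ?g n) \<le> pabs (of_nat M :: 'a)" for n
  proof -
    have "?g n - ?f n = (of_nat ((M - 1) choose n) - (- 1) ^ n) * (t ^ Suc n / of_nat (Suc n))"
      by (simp add: diff_divide_distrib left_diff_distrib del: of_nat_Suc power_Suc)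
    then have "pabs (?f n - ?g n)
        = pabs (of_nat ((M - 1) choose n) - (- 1) ^ n :: 'a) * pabs (t ^ Suc n / of_nat (Suc n))"
      by (metis pabs_minus_commute pabs_mult)
    also have "\<dots> \<le> pabs (of_nat M / fact n :: 'a) * pabs (t ^ Suc n / of_nat (Suc n))"
      by (intro mult_right_mono pabs_binomial_alternating assms) auto
    \<comment> \<open>The denominators \<open>fact n\<close> and \<open>Suc n\<close> combine to
      \<open>fact (Suc n)\<close>, giving a term of the exponential series.\<close>
    also have "\<dots> = pabs (of_nat M :: 'a) * pabs (t ^ Suc n / fact (Suc n))"
      by (simp add: pabs_mult pabs_divide mult_ac del: of_nat_Suc power_Suc)
    also have "\<dots> \<le> pabs (of_nat M :: 'a) * 1"
      using pabs_exp_term_le_arg[of "Suc n" t] t radius_less_1 by (intro mult_left_mono) auto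
    finally show ?thesis by simp
  qed
  have "q ^ M - 1 = of_nat M * sum ?g {..<N}" if "N \<ge> M" for N
  proof -
    have "q ^ M - 1 = t * qnat q M"
      using qnat_geometric[of q M] by (simp add: t_def algebra_simps)
    also have "\<dots> = of_nat M * (t * (\<Sum>k<N. of_nat ((M - 1) choose k) * t ^ k / of_nat (Suc k)))"
      unfolding qnat_binomial'[OF that] t_def by (simp only: mult_ac)
    also have "t * (\<Sum>k<N. of_nat ((M - 1) choose k) * t ^ k / of_nat (Suc k)) = sum ?g {..<N}"
      by (simp add: sum_distrib_left mult_ac del: of_nat_Suc)
    finally show ?thesis .
  qed
  then have g: "(q ^ M - 1) / of_nat M = sum ?g {..<N}" if "N \<ge> M" for N
    using that assms by (simp add: field_simps)
  have "pabs (sum ?f {..<N} - (q ^ M - 1) / of_nat M) \<le> pabs (of_nat M :: 'a)" if "N \<ge> M" for N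
    unfolding g[OF that] sum_subtractf[symmetric] by (intro pabs_sum_le diff) auto
  then have "pabs (padic_log q - (q ^ M - 1) / of_nat M) \<le> pabs (of_nat M :: 'a)"
    using log_sums(1)[OF q] unfolding sums_def t_def
    by (intro pabs_limit_le) (auto simp: eventually_at_top_linorder)
  then have "pabs (of_nat M :: 'a) * pabs (padic_log q - (q ^ M - 1) / of_nat M)
      \<le> pabs (of_nat M :: 'a) * pabs (of_nat M :: 'a)"
    by (intro mult_left_mono) auto
  moreover have "of_nat M * (padic_log q - (q ^ M - 1) / of_nat M)
      = of_nat M * padic_log q - (q ^ M - 1)"
    using assms by (simp add: field_simps)
  ultimately show ?thesis
    by (metis pabs_minus_commute pabs_mult power2_eq_square)
qed

lemma padic_exp_log:
  assumes q: "pabs (1 - q :: 'a) < radius"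
  shows "padic_exp (padic_log q) = q"
proof -
  define L where "L = padic_log q"
  define w where "w = padic_exp L / q"
  have L: "pabs L \<le> pabs (1 - q)" "pabs L < radius"
    using log_sums(2)[OF q] q by (auto simp: L_def)
  have q1: "pabs q = 1"
    using pabs_eq_if_close[of q 1] q radius_less_1 by (simp add: pabs_minus_commute)
  then have q0: "q \<noteq> 0" by auto
  \<comment> \<open>The quotient \<open>w\<close> has to lie in the disc itself, so that
    \<open>pabs_1_minus_power\<close> evaluates \<open>1 - w ^ M\<close> exactly.\<close>
  have "pabs ((padic_exp L - 1) + (1 - q)) < radius"
    using pabs_exp_minus_1_le[OF L(2)] L q by (intro pabs_add_less) auto
  moreover have "1 - w = (q - padic_exp L) / q"
    using q0 by (simp add: w_def field_simps)
  ultimately have w: "pabs (1 - w) < radius"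
    by (simp add: pabs_divide q1 pabs_minus_commute)
  have "pabs (w - 1) \<le> (1 / real p) ^ N" for N
  proof -
    define M where "M = p ^ N"
    have M: "M > 0" using p_gt_2 by (simp add: M_def)
    have absM: "pabs (of_nat M :: 'a) = (1 / real p) ^ N"
      by (simp add: M_def pabs_power pabs_p)
    have absML: "pabs (of_nat M * L) < radius"
      using L by (intro pabs_of_nat_mult_less)
    \<comment> \<open>Truncation after the linear term; the error is quadratic, and
      \<open>pabs L < radius\<close> absorbs the denominator.\<close>
    have "pabs (padic_exp (of_nat M * L) - (1 + of_nat M * L)) \<le> (pabs (of_nat M * L) / radius) ^ 2"
      using exp_sums(2)[OF order_refl absML, of 2] by (simp add: eval_nat_numeral)
    also have "\<dots> \<le> pabs (of_nat M :: 'a) ^ 2"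
      using L radius_pos mult_left_mono[of "pabs L" radius "pabs (of_nat M :: 'a)"]
      by (intro power_mono) (auto simp: pabs_mult divide_le_eq)
    finally have "pabs ((padic_exp (of_nat M * L) - (1 + of_nat M * L))
        - (q ^ M - 1 - of_nat M * L)) \<le> pabs (of_nat M :: 'a) ^ 2"
      using pabs_power_minus_log_le[OF q M] unfolding L_def by (rule pabs_diff_le)
    then have "pabs (padic_exp L ^ M - q ^ M) \<le> pabs (of_nat M :: 'a) ^ 2"
      using padic_exp_of_nat_mult[OF L(2)] by simp
    moreover have "1 - w ^ M = (q ^ M - padic_exp L ^ M) / q ^ M"
      using q0 by (simp add: w_def field_simps)
    ultimately have "pabs (1 - w ^ M) \<le> pabs (of_nat M :: 'a) ^ 2"
      by (simp add: pabs_divide pabs_power q1 pabs_minus_commute)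
    then have "pabs (of_nat M :: 'a) * pabs (1 - w) \<le> pabs (of_nat M :: 'a) * pabs (of_nat M :: 'a)"
      unfolding pabs_1_minus_power[OF w] by (simp add: power2_eq_square)
    then have "pabs (1 - w) \<le> pabs (of_nat M :: 'a)"
      using M pabs_nonneg[of "of_nat M"] pabs_eq_0[of "of_nat M"]
      by (metis less_le mult_left_le_imp_le of_nat_eq_0_iff less_irrefl)
    then show ?thesis using absM by (simp add: pabs_minus_commute)
  qed
  then have "w = 1"
    using p_gt_2 by (intro eq_if_geometrically_close) auto
  then show ?thesis using q0 by (simp add: w_def L_def field_simps)
qed

section \<open>Powers with p-adic exponents and brackets\<close>

lemma padic_pow_of_nat_minus:
  assumes "pabs (1 - q :: 'a) < radius"
  shows "padic_pow q (- of_nat n) = q powi (- int n)"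
proof -
  have L: "pabs (padic_log q) < radius" using log_sums(2)[OF assms] assms by simp
  then have "padic_exp (- (of_nat n * padic_log q)) = inverse (q ^ n)"
    by (simp add: padic_exp_minus pabs_of_nat_mult_less padic_exp_of_nat_mult padic_exp_log[OF assms])
  then show ?thesis by (simp add: padic_pow_def power_int_minus)
qed

lemma padic_pow_add_of_nat:
  assumes "pabs (1 - q :: 'a) < radius" "pabs x \<le> 1"
  shows "padic_pow q (x + of_nat n) = padic_pow q x * q ^ n"
proof -
  have L: "pabs (padic_log q) < radius" using log_sums(2)[OF assms(1)] assms by simp
  have "pabs (x * padic_log q) < radius"
    using mult_right_mono[OF assms(2) pabs_nonneg[of "padic_log q"]] L by (simp add: pabs_mult)
  then show ?thesis
    using L padic_exp_add[of "x * padic_log q" "of_nat n * padic_log q"]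
    by (simp add: padic_pow_def pabs_of_nat_mult_less padic_exp_of_nat_mult padic_exp_log[OF assms(1)]
        distrib_right)
qed

text \<open>With \<open>qnat\<close> in place of a quotient the addition rule includes
  \<open>q = 1\<close>, where it reads \<open>x + n = x + 1 * n\<close>.\<close>

lemma qbracket_1_add_of_nat:
  assumes "pabs (1 - q :: 'a) < radius" "pabs x \<le> 1"
  shows "qbracket q 1 (x + of_nat n) = qbracket q 1 x + padic_pow q x * qnat q n"
proof (cases "q = 1")
  case True
  have "padic_log (1 :: 'a) = 0"
    using log_sums(2)[of 1] radius_pos by simp
  then show ?thesis
    by (simp add: True qbracket_def qnat_def padic_pow_def padic_exp_0)
next
  case False
  then have "qnat q n = (1 - q ^ n) / (1 - q)"
    using qnat_geometric[of q n] by (simp add: eq_divide_eq)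
  then show ?thesis
    using False
    by (simp add: qbracket_def padic_pow_add_of_nat[OF assms] right_diff_distrib flip: add_divide_distrib)
qed

lemma qbracket_1_of_nat:
  assumes "pabs (1 - q :: 'a) < radius"
  shows "qbracket q 1 (of_nat n) = qnat q n"
  using qbracket_1_add_of_nat[OF assms, of 0 n]
  by (simp add: qbracket_def padic_pow_def padic_exp_0)

lemma qnat_neq_0:
  assumes "pabs (1 - q :: 'a) < radius" "n > 0"
  shows "qnat q n \<noteq> 0"
  using pabs_qnat[OF assms(1), of n] assms(2) pabs_eq_0
  by (metis of_nat_eq_0_iff less_irrefl)

text \<open>Since \<open>qnat q l\<close> is nonzero, \<open>q ^ l = 1\<close> happens only for
  \<open>q = 1\<close>; hence both brackets fall into the same case of
  \<open>qbracket\<close>.\<close>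

lemma qbracket_rescale:
  assumes "pabs (1 - q :: 'a) < radius" "l > 0"
  shows "qbracket q l z = qbracket q 1 (of_nat l * z) / qnat q l"
proof (cases "q = 1")
  case True
  then show ?thesis using assms by (simp add: qbracket_def qnat_def)
next
  case False
  then have "q ^ l \<noteq> 1"
    using qnat_geometric[of q l] qnat_neq_0[OF assms] by auto
  then show ?thesis
    using False by (simp add: qbracket_def mult.commute flip: qnat_geometric)
qed

subsection \<open>Fermionic integrals\<close>

text \<open>Lipschitz continuity for the p-adic metric on the natural numbers, the only points at
  which the sums defining the integral evaluate a function. It yields \<open>g (p ^ N)\<close>
  tending to \<open>g 0\<close>.\<close>

definition nat_lipschitz :: "(nat \<Rightarrow> 'a) \<Rightarrow> bool" where
  "nat_lipschitz f \<longleftrightarrow> (\<exists>C. \<forall>n d. pabs (f (n + d) - f n) \<le> C * pabs (of_nat d :: 'a))"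

lemma nat_lipschitz_add:
  assumes "nat_lipschitz f" "nat_lipschitz g"
  shows "nat_lipschitz (\<lambda>n. f n + g n)"
proof -
  obtain C D where C: "\<And>n d. pabs (f (n + d) - f n) \<le> C * pabs (of_nat d :: 'a)"
    and D: "\<And>n d. pabs (g (n + d) - g n) \<le> D * pabs (of_nat d :: 'a)"
    using assms unfolding nat_lipschitz_def by blast
  have "pabs ((f (n + d) - f n) + (g (n + d) - g n)) \<le> max C D * pabs (of_nat d :: 'a)" for n d
    using order_trans[OF C[of n d] mult_right_mono[of C "max C D"]]
      order_trans[OF D[of n d] mult_right_mono[of D "max C D"]]
    by (intro pabs_add_le) auto
  then show ?thesis
    unfolding nat_lipschitz_def by (intro exI[of _ "max C D"]) (simp add: algebra_simps)
qed

lemma nat_lipschitz_const: "nat_lipschitz (\<lambda>_. c)"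
  unfolding nat_lipschitz_def by (intro exI[of _ 0]) simp

lemma nat_lipschitz_sum:
  "(\<And>i. i \<in> A \<Longrightarrow> nat_lipschitz (f i)) \<Longrightarrow> nat_lipschitz (\<lambda>n. \<Sum>i\<in>A. f i n)"
proof (induction A rule: infinite_finite_induct)
  case (insert i A)
  then have "nat_lipschitz (\<lambda>n. f i n + (\<Sum>i\<in>A. f i n))"
    by (intro nat_lipschitz_add[of "f i"]) auto
  then show ?case using insert by simp
qed (simp_all add: nat_lipschitz_const)

lemma nat_lipschitz_mult:
  assumes "nat_lipschitz f" "nat_lipschitz g" "\<And>n. pabs (f n) \<le> A" "\<And>n. pabs (g n) \<le> B"
  shows "nat_lipschitz (\<lambda>n. f n * g n)"
proof -
  obtain C D where C: "\<And>n d. pabs (f (n + d) - f n) \<le> C * pabs (of_nat d :: 'a)"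
    and D: "\<And>n d. pabs (g (n + d) - g n) \<le> D * pabs (of_nat d :: 'a)"
    using assms(1,2) unfolding nat_lipschitz_def by blast
  have pos: "A \<ge> 0" "B \<ge> 0"
    using assms(3,4) pabs_nonneg order_trans by blast+
  let ?C = "max (B * C) (A * D)"
  have "pabs (f (n + d) * g (n + d) - f n * g n) \<le> ?C * pabs (of_nat d :: 'a)" for n d
  proof -
    have "pabs ((f (n + d) - f n) * g (n + d)) \<le> (C * pabs (of_nat d :: 'a)) * B"
      unfolding pabs_mult using C[of n d] assms(4)
      by (intro mult_mono) (auto intro: order_trans[OF pabs_nonneg])
    also have "\<dots> = (B * C) * pabs (of_nat d :: 'a)" by simp
    also have "\<dots> \<le> ?C * pabs (of_nat d :: 'a)" by (intro mult_right_mono) auto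
    finally have 1: "pabs ((f (n + d) - f n) * g (n + d)) \<le> ?C * pabs (of_nat d :: 'a)" .
    have "pabs (f n * (g (n + d) - g n)) \<le> A * (D * pabs (of_nat d :: 'a))"
      unfolding pabs_mult using D[of n d] assms(3) pos by (intro mult_mono) auto
    also have "\<dots> = (A * D) * pabs (of_nat d :: 'a)" by simp
    also have "\<dots> \<le> ?C * pabs (of_nat d :: 'a)" by (intro mult_right_mono) auto
    finally have 2: "pabs (f n * (g (n + d) - g n)) \<le> ?C * pabs (of_nat d :: 'a)" .
    show ?thesis using pabs_add_le[OF 1 2] by (simp add: algebra_simps)
  qed
  then show ?thesis unfolding nat_lipschitz_def by blast
qed

lemma nat_lipschitz_cmult: "nat_lipschitz f \<Longrightarrow> nat_lipschitz (\<lambda>n. c * f n)"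
proof -
  assume "nat_lipschitz f"
  then obtain C where C: "\<And>n d. pabs (f (n + d) - f n) \<le> C * pabs (of_nat d :: 'a)"
    unfolding nat_lipschitz_def by blast
  have "pabs (c * f (n + d) - c * f n) \<le> (pabs c * C) * pabs (of_nat d :: 'a)" for n d
    using mult_left_mono[OF C[of n d] pabs_nonneg[of c]]
    by (simp add: pabs_mult flip: right_diff_distrib)
  then show ?thesis unfolding nat_lipschitz_def by blast
qed

lemma nat_lipschitz_shift: "nat_lipschitz f \<Longrightarrow> nat_lipschitz (\<lambda>n. f (n + s))"
  unfolding nat_lipschitz_def by (metis add.assoc add.commute)

lemma nat_lipschitz_shift_average:
  "nat_lipschitz f \<Longrightarrow> nat_lipschitz (shift_average q l k f)"
  unfolding shift_average_def[abs_def]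
  by (rule nat_lipschitz_sum, rule nat_lipschitz_cmult, rule nat_lipschitz_shift)

lemma pabs_base:
  assumes "pabs (1 - q :: 'a) < radius"
  shows "pabs q = 1"
  using pabs_eq_if_close[of q 1] assms radius_less_1 by (simp add: pabs_minus_commute)

lemma pabs_1_minus_power_less:
  assumes "pabs (1 - q :: 'a) < radius"
  shows "pabs (1 - q ^ n) < radius"
  using pabs_1_minus_power[OF assms] pabs_of_nat_mult_less[OF assms] by (simp add: pabs_mult)

lemma pabs_1_plus:
  assumes "pabs (1 - q :: 'a) < radius"
  shows "pabs (1 + q) = 1"
  using pabs_eq_if_close[of "1 + q" 2] assms radius_less_1 pabs_2
  by (simp add: pabs_minus_commute)

text \<open>The increment of \<open>qnat q\<close> from \<open>n\<close> to \<open>n + d\<close> is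
  \<open>q ^ n * qnat q d\<close>, whose absolute value is that of \<open>d\<close>. The product
  rule extends this to powers.\<close>

lemma nat_lipschitz_poly_qnat:
  assumes "pabs (1 - q :: 'a) < radius"
  shows "nat_lipschitz (\<lambda>n. poly P (qnat q n))"
proof -
  have le1: "pabs (qnat q n) \<le> 1" for n
    by (simp add: pabs_qnat[OF assms])
  have "pabs (qnat q (n + d) - qnat q n) \<le> 1 * pabs (of_nat d :: 'a)" for n d
    by (simp add: qnat_add pabs_mult pabs_power pabs_base[OF assms] pabs_qnat[OF assms])
  then have lip: "nat_lipschitz (qnat q)"
    unfolding nat_lipschitz_def by blast
  have "nat_lipschitz (\<lambda>n. qnat q n ^ d)" for d
  proof (induction d)
    case (Suc d)
    then show ?case
      using nat_lipschitz_mult[OF lip Suc.IH le1, of 1]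
      by (simp add: pabs_power power_le_one le1)
  qed (simp add: nat_lipschitz_const)
  then show ?thesis
    unfolding poly_altdef by (intro nat_lipschitz_sum nat_lipschitz_cmult)
qed

text \<open>The equation for \<open>g\<close> makes the sums telescope. The Lipschitz bound then
  proves convergence, so that \<open>lim\<close> denotes a genuine limit.\<close>

lemma fermionic_integral_eqI:
  fixes f :: "'a \<Rightarrow> 'a" and g :: "nat \<Rightarrow> 'a"
  assumes Q: "pabs (1 - Q) < radius" and g: "nat_lipschitz g"
    and eq: "\<And>x. (1 + Q) * f (of_nat x) = g x + Q * g (Suc x)"
  shows "fermionic_integral p Q f = g 0"
proof -
  obtain C where C: "\<And>n d. pabs (g (n + d) - g n) \<le> C * pabs (of_nat d :: 'a)"
    using g unfolding nat_lipschitz_def by blast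
  let ?X = "\<lambda>N. (1 + Q) / (1 + Q ^ (p ^ N)) * (\<Sum>x<p ^ N. f (of_nat x) * (- 1) ^ x * Q ^ x)"
  have X: "pabs (?X N - g 0) \<le> C * (1 / real p) ^ N" for N
  proof -
    define M where "M = p ^ N"
    \<comment> \<open>Oddness turns the boundary term \<open>- ((- Q) ^ M)\<close> into
      \<open>Q ^ M\<close>, so numerator and denominator match.\<close>
    have "odd M" using odd_p by (simp add: M_def)
    have unit: "pabs (1 + Q ^ M) = 1"
      by (intro pabs_1_plus pabs_1_minus_power_less Q)
    then have nz: "1 + Q ^ M \<noteq> 0" by auto
    have "(1 + Q) * (\<Sum>x<M. f (of_nat x) * (- 1) ^ x * Q ^ x)
        = (\<Sum>x<M. (- Q) ^ x * ((1 + Q) * f (of_nat x)))"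
      by (simp add: sum_distrib_left power_minus[of Q] mult_ac)
    also have "\<dots> = (\<Sum>x<M. (- Q) ^ x * g x - (- Q) ^ Suc x * g (Suc x))"
      unfolding eq by (intro sum.cong) (auto simp: algebra_simps)
    also have "\<dots> = g 0 + Q ^ M * g M"
      using \<open>odd M\<close> by (subst sum_lessThan_telescope') simp
    finally have "?X N = (g 0 + Q ^ M * g M) / (1 + Q ^ M)"
      by (simp add: M_def)
    also have "\<dots> - g 0 = Q ^ M * (g M - g 0) / (1 + Q ^ M)"
      using nz by (simp add: divide_simps) (simp add: algebra_simps)
    finally have "pabs (?X N - g 0) = pabs (g M - g 0)"
      by (simp add: pabs_divide pabs_mult unit pabs_power pabs_base[OF Q])
    also have "\<dots> \<le> C * pabs (of_nat M :: 'a)"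
      using C[of 0 M] by simp
    also have "\<dots> = C * (1 / real p) ^ N"
      by (simp add: M_def pabs_power pabs_p)
    finally show ?thesis .
  qed
  have "(\<lambda>N. C * (1 / real p) ^ N) \<longlonglongrightarrow> C * 0"
    using p_gt_2 by (intro tendsto_mult tendsto_const LIMSEQ_power_zero) auto
  then have "(\<lambda>N. C * (1 / real p) ^ N) \<longlonglongrightarrow> 0" by simp
  then have "(\<lambda>N. pabs (?X N - g 0)) \<longlonglongrightarrow> 0"
    by (rule tendsto_sandwich[OF _ _ tendsto_const, rotated 2]) (use X in simp_all)
  then show ?thesis
    unfolding fermionic_integral_def by (intro limI) (simp add: tendsto_iff_pabs)
qed

lemma nat_lipschitz_geometric:
  assumes Q: "pabs (1 - Q) < radius"
  shows "nat_lipschitz (\<lambda>n. Q powi (- int (j * n)))"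
proof -
  have Q0: "Q \<noteq> 0" using pabs_base[OF Q] by auto
  have "pabs (Q powi (- int (j * (n + d))) - Q powi (- int (j * n))) \<le> 1 * pabs (of_nat d :: 'a)"
    for n d
  proof -
    have "Q powi (- int (j * (n + d))) - Q powi (- int (j * n))
        = (1 - Q ^ (j * d)) * inverse (Q ^ (j * (n + d)))"
      using Q0 by (simp add: power_int_minus power_add field_simps del: of_nat_add of_nat_mult)
    also have "pabs \<dots> = pabs (of_nat (j * d) :: 'a) * pabs (1 - Q)"
      by (simp add: pabs_mult pabs_inverse pabs_power pabs_base[OF Q] pabs_1_minus_power[OF Q])
    also have "\<dots> = pabs (of_nat d :: 'a) * (pabs (of_nat j :: 'a) * pabs (1 - Q))"
      by (simp add: pabs_mult)
    also have "\<dots> \<le> pabs (of_nat d :: 'a) * 1"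
      using Q radius_less_1 by (intro mult_left_mono mult_le_one) auto
    finally show ?thesis by simp
  qed
  then show ?thesis unfolding nat_lipschitz_def by blast
qed

lemma nat_lipschitz_bounded:
  assumes "nat_lipschitz f"
  shows "\<exists>A. \<forall>n. pabs (f n) \<le> A"
proof -
  obtain C where C: "\<And>n d. pabs (f (n + d) - f n) \<le> C * pabs (of_nat d :: 'a)"
    using assms unfolding nat_lipschitz_def by blast
  have "pabs (f n) \<le> max \<bar>C\<bar> (pabs (f 0))" for n
  proof -
    have "C * pabs (of_nat n :: 'a) \<le> \<bar>C\<bar> * 1"
      by (intro mult_mono) auto
    then have "pabs (f n - f 0) \<le> \<bar>C\<bar>" using C[of 0 n] by simp
    then show ?thesis
      using pabs_add_le[of "f n - f 0" "max \<bar>C\<bar> (pabs (f 0))" "f 0"] by auto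
  qed
  then show ?thesis by blast
qed

lemma nat_lipschitz_dilate: "nat_lipschitz f \<Longrightarrow> nat_lipschitz (\<lambda>t. f (n + l * t))"
proof -
  assume "nat_lipschitz f"
  then obtain C where C: "\<And>n d. pabs (f (n + d) - f n) \<le> C * pabs (of_nat d :: 'a)"
    unfolding nat_lipschitz_def by blast
  have "pabs (f (n + l * (t + d)) - f (n + l * t)) \<le> (C * pabs (of_nat l :: 'a)) * pabs (of_nat d :: 'a)"
    for t d
    using C[of "n + l * t" "l * d"] by (simp add: algebra_simps pabs_mult)
  then show ?thesis unfolding nat_lipschitz_def by blast
qed

text \<open>Induction on the number of variables. The step evaluates the integral over the outermost
  variable, with \<open>F\<close> known only at natural arguments.\<close>

lemma iterated_fermionic_integral_eq:
  fixes F :: "(nat \<Rightarrow> 'a) \<Rightarrow> 'a" and \<psi> :: "nat \<Rightarrow> nat \<Rightarrow> 'a"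
  assumes Q: "pabs (1 - Q) < radius"
    and lip: "\<And>k. nat_lipschitz (\<psi> k)"
    and eq: "\<And>k n. \<psi> (Suc k) n + Q powi (- int k) * \<psi> (Suc k) (n + l) = (1 + Q) * \<psi> k n"
    and F: "\<And>v. F (\<lambda>j. of_nat (v j)) =
      c * \<psi> 0 (n + l * (\<Sum>j=1..k. v j)) * Q powi (- int (\<Sum>j=1..k. j * v j))"
  shows "iterated_fermionic_integral p Q k F = c * \<psi> k n"
  using F
proof (induction k arbitrary: F c n)
  case 0
  then show ?case using "0"[of "\<lambda>_. 0"] by simp
next
  case (Suc k)
  have Q0: "Q \<noteq> 0" using pabs_base[OF Q] by auto
  \<comment> \<open>Fixing the outermost variable at \<open>t\<close> moves \<open>n\<close> to
    \<open>n + l * t\<close> and puts a power of \<open>Q\<close> into the constant; hence the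
    induction varies both \<open>n\<close> and \<open>c\<close>.\<close>
  have inner: "iterated_fermionic_integral p Q k (\<lambda>x. F (x(Suc k := of_nat t)))
      = (c * Q powi (- int (Suc k * t))) * \<psi> k (n + l * t)" for t
  proof (rule Suc.IH)
    fix v :: "nat \<Rightarrow> nat"
    have "(\<lambda>j. of_nat (v j) :: 'a)(Suc k := of_nat t) = (\<lambda>j. of_nat ((v(Suc k := t)) j))"
      by auto
    moreover have "(\<Sum>j=1..Suc k. (v(Suc k := t)) j) = (\<Sum>j=1..k. v j) + t"
      "(\<Sum>j=1..Suc k. j * (v(Suc k := t)) j) = (\<Sum>j=1..k. j * v j) + Suc k * t"
      by (auto intro!: sum.cong)
    ultimately show "F ((\<lambda>j. of_nat (v j))(Suc k := of_nat t)) = c * Q powi (- int (Suc k * t)) *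
       \<psi> 0 (n + l * t + l * (\<Sum>j=1..k. v j)) * Q powi (- int (\<Sum>j=1..k. j * v j))"
      using Suc.prems[of "v(Suc k := t)"]
      by (simp add: minus_of_nat_powi power_add distrib_left mult_ac add_ac
          del: of_nat_add of_nat_mult of_nat_Suc fun_upd_apply sum.cl_ivl_Suc of_nat_sum mult_Suc)
  qed
  define g where "g t = c * (Q powi (- int (Suc k * t)) * \<psi> (Suc k) (n + l * t))" for t
  obtain A where A: "\<And>t. pabs (\<psi> (Suc k) (n + l * t)) \<le> A"
    using nat_lipschitz_bounded[OF lip] by blast
  have B: "pabs (Q powi (- int (Suc k * t))) \<le> 1" for t
    by (simp add: minus_of_nat_powi pabs_inverse pabs_power pabs_base[OF Q]
        del: of_nat_mult of_nat_add mult_Suc)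
  have "nat_lipschitz g"
    unfolding g_def
    by (intro nat_lipschitz_cmult nat_lipschitz_mult[OF _ _ B A] nat_lipschitz_geometric
        nat_lipschitz_dilate Q lip)
  moreover have "(1 + Q) * ((c * Q powi (- int (Suc k * t))) * \<psi> k (n + l * t)) = g t + Q * g (Suc t)"
    for t
  proof -
    have "(1 + Q) * ((c * Q powi (- int (Suc k * t))) * \<psi> k (n + l * t))
        = c * Q powi (- int (Suc k * t)) * ((1 + Q) * \<psi> k (n + l * t))"
      by (simp only: mult_ac)
    also have "\<dots> = c * Q powi (- int (Suc k * t)) * (\<psi> (Suc k) (n + l * t)
        + Q powi (- int k) * \<psi> (Suc k) (n + l * Suc t))"
      by (simp add: eq[symmetric] add_ac)
    also have "\<dots> = g t + c * (Q powi (- int (Suc k * t)) * Q powi (- int k))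
        * \<psi> (Suc k) (n + l * Suc t)"
      by (simp add: g_def distrib_left mult_ac del: mult_Suc mult_Suc_right)
    \<comment> \<open>The exponents satisfy
      \<open>- (k + 1) * t - k = 1 - (k + 1) * (t + 1)\<close>. The extra 1 is the factor
      \<open>Q\<close> required by \<open>fermionic_integral_eqI\<close>.\<close>
    also have "Q powi (- int (Suc k * t)) * Q powi (- int k) = Q * Q powi (- int (Suc k * Suc t))"
      using Q0 by (simp add: power_int_minus power_add field_simps del: of_nat_add of_nat_mult of_nat_Suc)
    finally show ?thesis by (simp add: g_def mult_ac del: mult_Suc mult_Suc_right)
  qed
  ultimately have "iterated_fermionic_integral p Q (Suc k) F = g 0"
    unfolding iterated_fermionic_integral.simps by (intro fermionic_integral_eqI Q) (auto simp only: inner)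
  then show ?case by (simp add: g_def)
qed

text \<open>At \<open>y = (x + n) / l\<close> the bracket argument times \<open>l\<close> is
  \<open>x\<close> plus a natural number, and rescaling the bracket produces the denominator. The
  lemma serves twice: with step \<open>l\<close> for the right-hand side of the theorem and with
  step 1 for the left.\<close>

lemma qEuler_eq:
  fixes \<psi> :: "nat \<Rightarrow> nat \<Rightarrow> 'a"
  assumes q: "pabs (1 - q) < radius" and x: "pabs x \<le> 1" and l: "l > 0"
    and lip: "\<And>k. nat_lipschitz (\<psi> k)"
    and init: "\<And>n. \<psi> 0 n = qbracket q 1 (x + of_nat n) ^ m"
    and eq: "\<And>k n. \<psi> (Suc k) n + (q ^ l) powi (- int k) * \<psi> (Suc k) (n + l) = (1 + q ^ l) * \<psi> k n"
  shows "qEuler p q l m k ((x + of_nat n) / of_nat l) = \<psi> k n / qnat q l ^ m"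
proof -
  have Q: "pabs (1 - q ^ l) < radius" by (rule pabs_1_minus_power_less[OF q])
  have "qEuler p q l m k ((x + of_nat n) / of_nat l) = (1 / qnat q l ^ m) * \<psi> k n"
    unfolding qEuler_def
  proof (rule iterated_fermionic_integral_eq[where \<psi> = \<psi>, OF Q lip eq])
    fix v :: "nat \<Rightarrow> nat"
    have arg: "of_nat l * ((x + of_nat n) / of_nat l + (\<Sum>j=1..k. of_nat (v j)))
        = x + of_nat (n + l * (\<Sum>j=1..k. v j))"
      using l by (subst distrib_left) simp
    have br: "qbracket q l ((x + of_nat n) / of_nat l + (\<Sum>j=1..k. of_nat (v j))) ^ m
        = 1 / qnat q l ^ m * \<psi> 0 (n + l * (\<Sum>j=1..k. v j))"
      unfolding qbracket_rescale[OF q l] arg init by (simp add: power_divide)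
    have "(\<Sum>j=1..k. of_nat j * of_nat (v j)) = (of_nat (\<Sum>j=1..k. j * v j) :: 'a)"
      by simp
    then show "qbracket q l ((x + of_nat n) / of_nat l + (\<Sum>j=1..k. of_nat (v j))) ^ m
        * padic_pow (q ^ l) (- (\<Sum>j=1..k. of_nat j * of_nat (v j)))
      = 1 / qnat q l ^ m * \<psi> 0 (n + l * (\<Sum>j=1..k. v j))
        * (q ^ l) powi (- int (\<Sum>j=1..k. j * v j))"
      unfolding br by (simp only: padic_pow_of_nat_minus[OF Q])
  qed
  then show ?thesis by simp
qed

text \<open>In the variable \<open>y = qnat q n\<close> the shift by \<open>l\<close> is the affine
  map to \<open>qnat q l + q ^ l * y\<close>, so polynomial solutions can be chosen one after
  another.\<close>

lemma exists_solution_sequence: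
  fixes q x :: 'a
  assumes q: "pabs (1 - q) < radius" and x: "pabs x \<le> 1"
  obtains \<psi> :: "nat \<Rightarrow> nat \<Rightarrow> 'a" where "\<And>k. nat_lipschitz (\<psi> k)"
    "\<And>n. \<psi> 0 n = qbracket q 1 (x + of_nat n) ^ m"
    "\<And>k n. \<psi> (Suc k) n + (q ^ l) powi (- int k) * \<psi> (Suc k) (n + l) = (1 + q ^ l) * \<psi> k n"
proof -
  have q0: "q \<noteq> 0" using pabs_base[OF q] by auto
  define P0 where "P0 = [:qbracket q 1 x, padic_pow q x:] ^ m"
  \<comment> \<open>Multiplied by \<open>q ^ (l * k)\<close>, the expression becomes a sum of two
    powers of \<open>q\<close>; this is close to 2, hence a unit.\<close>
  have nz: "1 + (q ^ l) powi (- int k) * (q ^ l) ^ r \<noteq> 0" for k r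
  proof -
    have "pabs (q ^ (l * k) + q ^ (l * r)) = 1"
    proof -
      have "pabs ((q ^ (l * k) + q ^ (l * r)) - 2) < 1"
        using pabs_add_less[of "q ^ (l * k) - 1" radius "q ^ (l * r) - 1"]
          pabs_1_minus_power_less[OF q] radius_less_1
        by (simp add: pabs_minus_commute[of _ 1] algebra_simps)
      then show ?thesis using pabs_eq_if_close pabs_2 by metis
    qed
    then have "q ^ (l * k) + q ^ (l * r) \<noteq> 0" by auto
    moreover have "q ^ (l * k) * (1 + (q ^ l) powi (- int k) * (q ^ l) ^ r) = q ^ (l * k) + q ^ (l * r)"
      using q0 by (simp add: power_int_minus power_mult distrib_left)
    ultimately show ?thesis by auto
  qed
  have step: "\<exists>P. \<forall>y. poly P y + (q ^ l) powi (- int k) * poly P (qnat q l + q ^ l * y)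
      = (1 + q ^ l) * poly R y" for k R
    using affine_functional_equation[OF nz, of k "qnat q l" "smult (1 + q ^ l) R"] by simp
  \<comment> \<open>\<open>G k\<close> selects a solution for each right-hand side; the recursion
    \<open>P\<close> iterates it from \<open>P0\<close>.\<close>
  obtain G where G: "poly (G k R) y + (q ^ l) powi (- int k) * poly (G k R) (qnat q l + q ^ l * y)
      = (1 + q ^ l) * poly R y" for k R y
    using step by metis
  define P where "P = rec_nat P0 G"
  have P: "P 0 = P0" "P (Suc k) = G k (P k)" for k
    by (auto simp: P_def)
  show ?thesis
  proof (rule that[of "\<lambda>k n. poly (P k) (qnat q n)"])
    show "nat_lipschitz (\<lambda>n. poly (P k) (qnat q n))" for k
      by (rule nat_lipschitz_poly_qnat[OF q])
    show "poly (P 0) (qnat q n) = qbracket q 1 (x + of_nat n) ^ m" for n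
      unfolding qbracket_1_add_of_nat[OF q x] by (simp add: P(1) P0_def mult.commute)
    show "poly (P (Suc k)) (qnat q n) + (q ^ l) powi (- int k) * poly (P (Suc k)) (qnat q (n + l))
        = (1 + q ^ l) * poly (P k) (qnat q n)" for k n
      unfolding P(2) add.commute[of n l] qnat_add by (rule G)
  qed
qed

text \<open>Stated on the closed unit disc, so that it applies to \<open>x\<close> and to
  \<open>of_nat l * x\<close> alike.\<close>

lemma qEuler_distribution:
  fixes q x :: 'a
  assumes q: "pabs (1 - q) < radius" and x: "pabs x \<le> 1" and l: "odd l"
  shows "qEuler p q 1 m k x =
    qbracket q 1 (of_nat l) ^ m / qbracket_minus q l ^ k *
    (\<Sum>i \<in> {1..k} \<rightarrow>\<^sub>E {0..<l}.
       q powi (- int (\<Sum>j=2..k. (j - 1) * i j)) * (- 1) ^ (\<Sum>j=1..k. i j) *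
       qEuler p q l m k ((x + of_nat (\<Sum>j=1..k. i j)) / of_nat l))"
proof -
  have l0: "l > 0" using l by (cases l) auto
  have q0: "q \<noteq> 0" using pabs_base[OF q] by auto
  obtain \<psi> :: "nat \<Rightarrow> nat \<Rightarrow> 'a" where lip: "\<And>k. nat_lipschitz (\<psi> k)"
    and init: "\<And>n. \<psi> 0 n = qbracket q 1 (x + of_nat n) ^ m"
    and eq: "\<And>k n. \<psi> (Suc k) n + (q ^ l) powi (- int k) * \<psi> (Suc k) (n + l) = (1 + q ^ l) * \<psi> k n"
    using exists_solution_sequence[OF q x] by blast
  \<comment> \<open>This is the reciprocal of \<open>qbracket_minus q l\<close>, because
    \<open>(- q) ^ l = - (q ^ l)\<close> for odd \<open>l\<close>. It converts the factor
    \<open>1 + q ^ l\<close> of each equation into \<open>1 + q\<close>.\<close>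
  define c where "c = (1 + q) / (1 + q ^ l)"
  have nz: "1 + q \<noteq> 0" "1 + q ^ l \<noteq> 0"
    using pabs_1_plus[OF q] pabs_1_plus[OF pabs_1_minus_power_less[OF q], of l] by auto
  have c: "c * (1 + q ^ l) = 1 + q" "c = 1 / qbracket_minus q l"
    using nz l by (auto simp: c_def qbracket_minus_def)
  define \<phi> where "\<phi> k n = c ^ k * shift_average q l k (\<psi> k) n" for k n
  \<comment> \<open>The averaged sequence \<open>\<phi>\<close> solves the equations with step 1, so
    \<open>qEuler_eq\<close> with step 1 and \<open>n = 0\<close> yields the left-hand side.\<close>
  have "qEuler p q 1 m k ((x + of_nat 0) / of_nat 1) = \<phi> k 0 / qnat q 1 ^ m"
  proof (rule qEuler_eq[where \<psi> = \<phi>, OF q x])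
    show "nat_lipschitz (\<phi> k)" for k
      unfolding \<phi>_def[abs_def] by (intro nat_lipschitz_cmult nat_lipschitz_shift_average lip)
    show "\<phi> 0 n = qbracket q 1 (x + of_nat n) ^ m" for n
      by (simp add: \<phi>_def shift_average_0 init)
    show "\<phi> (Suc k) n + (q ^ 1) powi (- int k) * \<phi> (Suc k) (n + 1) = (1 + q ^ 1) * \<phi> k n" for k n
    proof -
      have "\<phi> (Suc k) n + (q ^ 1) powi (- int k) * \<phi> (Suc k) (n + 1)
        = c ^ Suc k * (shift_average q l (Suc k) (\<psi> (Suc k)) n
            + q powi (- int k) * shift_average q l (Suc k) (\<psi> (Suc k)) (n + 1))"
        by (simp add: \<phi>_def algebra_simps)
      also have "\<dots> = c ^ Suc k * ((1 + q ^ l) * shift_average q l k (\<psi> k) n)"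
        by (subst shift_average_telescope[OF q0 l, where c = "1 + q ^ l" and g = "\<psi> k"]) (auto simp: eq)
      also have "\<dots> = (c * (1 + q ^ l)) * \<phi> k n"
        by (simp add: \<phi>_def)
      finally show ?thesis by (simp add: c(1))
    qed
  qed simp
  then have "qEuler p q 1 m k x = \<phi> k 0"
    by (simp add: qnat_def)
  \<comment> \<open>Now \<open>qEuler_eq\<close> with step \<open>l\<close> is read backwards,
    replacing each value of \<open>\<psi> k\<close> by a polynomial value to base
    \<open>q ^ l\<close>.\<close>
  also have "\<dots> = c ^ k * qnat q l ^ m * shift_average q l k (\<lambda>n. qEuler p q l m k ((x + of_nat n) / of_nat l)) 0"
    unfolding qEuler_eq[where \<psi> = \<psi>, OF q x l0 lip init eq]
    using qnat_neq_0[OF q l0] shift_average_mult[of q l k "1 / qnat q l ^ m" "\<psi> k" 0]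
    by (simp add: \<phi>_def)
  finally show ?thesis
    unfolding qbracket_1_of_nat[OF q] c(2) power_one_over shift_average_def add_0 by simp
qed

end

theorem theorem3:
  fixes p l k m :: nat
    and q x :: "'a::{field_char_0, complete_space}"
  assumes "is_padic_complex p TYPE('a)"
    and "odd p"
    and "pabs (1 - q) < real p powr (- 1 / (real p - 1))"
    and "odd l"
    and "k \<ge> 1"
    and "x \<in> padic_ints"
  shows "(qEuler p q 1 m k x =
           qbracket q 1 (of_nat l) ^ m / qbracket_minus q l ^ k *
           (\<Sum>i \<in> {1..k} \<rightarrow>\<^sub>E {0..<l}.
              q powi (- int (\<Sum>j=2..k. (j - 1) * i j)) * (- 1) ^ (\<Sum>j=1..k. i j) *
              qEuler p q l m k ((x + of_nat (\<Sum>j=1..k. i j)) / of_nat l))) \<and>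
         (qEuler p q 1 m k (of_nat l * x) =
           qbracket q 1 (of_nat l) ^ m / qbracket_minus q l ^ k *
           (\<Sum>i \<in> {1..k} \<rightarrow>\<^sub>E {0..<l}.
              q powi (- int (\<Sum>j=2..k. (j - 1) * i j)) * (- 1) ^ (\<Sum>j=1..k. i j) *
              qEuler p q l m k (x + of_nat (\<Sum>j=1..k. i j) / of_nat l)))"
proof -
  interpret odd_padic_complex p "TYPE('a)"
    using assms by unfold_locales
  have q: "pabs (1 - q) < radius"
    using assms by (simp add: radius_def)
  have x: "pabs x \<le> 1"
    using assms by (simp add: padic_ints_def)
  then have lx: "pabs (of_nat l * x) \<le> 1"
    by (simp add: pabs_mult mult_le_one)
  have "l \<noteq> 0" using assms by (cases l) auto
  \<comment> \<open>The second identity is the first one at \<open>of_nat l * x\<close>, once its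
    arguments are put over the denominator \<open>l\<close>.\<close>
  then have div: "x + of_nat s / of_nat l = (of_nat l * x + of_nat s) / of_nat l" for s
    by (simp add: add_divide_distrib)
  show ?thesis
    unfolding div
    using qEuler_distribution[OF q x \<open>odd l\<close>] qEuler_distribution[OF q lx \<open>odd l\<close>] by blast
qed

end
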